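(* Assume $\eta(\xi_0^{(0)}=0)=1$ and $\eta(D)=1$, where $D=\{\bar\xi: d(\bar\xi,s)=0\text{ for every } s\in(0,\infty)\}$. Then $y_n(\bar\xi,Z_n(\bar\xi))$ converges almost surely, as $n\to\infty$, to a random variable $Y(\bar\xi)$, and for $\eta$-a.e. $\bar\xi$ one has $Y(\bar\xi)\in(0,1)$ $P_{\bar\xi}$-almost surely. Moreover, for $\eta$-a.e. $\bar\xi$: if $s_r\in(0,\infty)$ is a $\bar\xi$-regular point and $x_r=e^{-s_r}$, then $P_{\bar\xi}(Y(\bar\xi)\le x_r)=x_r$ and $P_{\bar\xi}(Y(\bar\xi)=x_r)=0$. In particular, if $\{Z_n\}$ is a regular branching process, then (for $\eta$-a.e. $\bar\xi$, under $P_{\bar\xi}$) $Y$ is uniformly distributed on $(0,1)$.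
   Context: Setting. $\bar\xi=\{\xi_n:n\in\mathbb Z\}$ is an i.i.d. sequence of random probability distributions $\xi_n=\{\xi_n^{(0)},\xi_n^{(1)},\dots\}$ on the nonnegative integers; the law of the environment $\bar\xi$ is $\eta$. Given $\bar\xi$, $Z_0=1$ and $Z_n=Z_n(\bar\xi)$ is the sum of $Z_{n-1}$ independent random variables each with distribution $\xi_{n-1}$. $P_{\bar\xi}$ is the (quenched) probability for fixed $\bar\xi$, and $\mathbb P(\cdot)=\int P_{\bar\xi}(\cdot)\,\eta(d\bar\xi)$. The shift is $(\theta\bar\xi)_n=\xi_{n+1}$. Notation. $f_{\xi_i}(s)=\sum_{j\ge0}\xi_i^{(j)}s^j$ and $f_{\xi_i}^{(-1)}$ is its inverse function; $f_n(\bar\xi,s)=f_{\xi_0}(\cdots(f_{\xi_{n-1}}(s))\cdots)$. For $0<x<\infty$, $y_n(\bar\xi,x)=f_{\xi_0}(\cdots(f_{\xi_{n-1}}(e^{-1/x}))\cdots)$, and $y_n(\bar\xi,0)=f_n(\bar\xi,0)$. For $0<s<\infty$, $h_{\xi_i}(s)=-\log f_{\xi_i}^{(-1)}(e^{-s})$, $h_n(\bar\xi,s)=h_{\xi_{n-1}}(\cdots(h_{\xi_0}(s))\cdots)$, with $h_0(\bar\xi,s)=s$, and $d(\bar\xi,s)=\lim_{n\to\infty}\dfrac{h_{n+1}(\bar\xi,s)}{h_n(\theta\bar\xi,s)}$. For each $s\in(0,\infty)$, $W(\bar\xi,s)\in[0,\infty]$ is the almost sure limit of $Z_n(\bar\xi)h_n(\bar\xi,s)$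 (it exists almost surely). Definitions. A point $s\in(0,\infty)$ is $\bar\xi$-regular if $P_{\bar\xi}(W(\bar\xi,s)\in\{0,\infty\})=1$. The process $\{Z_n(\bar\xi)\}$ is $\bar\xi$-regular if all $s\in(0,\infty)$ are $\bar\xi$-regular. The branching process in random environment $\{Z_n\}$ is a regular branching process if $\eta(\{\bar\xi: \{Z_n(\bar\xi)\}\text{ is }\bar\xi\text{-regular}\})=1$. *)

theory Defs
  imports "HOL-Probability.Probability"
begin

text \<open>The space of probability distributions on the nonnegative integers, with the
  sigma-algebra generated by the maps p \<open>\<mapsto>\<close> p(A).\<close>

definition dist_space :: "nat pmf measure" where
  "dist_space = vimage_algebra UNIV measure_pmf (prob_algebra (count_space UNIV))"

type_synonym environment = "int \<Rightarrow> nat pmf"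

text \<open>The law \<open>\<eta>\<close> of an i.i.d. environment whose one-site law is \<open>\<mu>\<close>.\<close>

definition env_law :: "nat pmf measure \<Rightarrow> environment measure" where
  "env_law \<mu> = Pi\<^sub>M UNIV (\<lambda>_. \<mu>)"

definition shift :: "environment \<Rightarrow> environment" where
  "shift \<xi> = (\<lambda>n. \<xi> (n + 1))"

text \<open>A family of offspring numbers: \<open>\<omega> (n, i)\<close> is the number of children of the \<open>i\<close>-th individual
  of generation \<open>n\<close>. Under the quenched law these are independent and \<open>\<omega> (n, i)\<close> has
  distribution \<open>\<xi> n\<close>.\<close>

type_synonym offspring = "nat \<times> nat \<Rightarrow> nat"

definition offspring_space :: "offspring measure" where
  "offspring_space = Pi\<^sub>M UNIV (\<lambda>_. count_space UNIV)"

definition quenched :: "environment \<Rightarrow> offspring measure" where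
  "quenched \<xi> = Pi\<^sub>M UNIV (\<lambda>(n, i). measure_pmf (\<xi> (int n)))"

primrec Z :: "nat \<Rightarrow> offspring \<Rightarrow> nat" where
  "Z 0 \<omega> = 1"
| "Z (Suc n) \<omega> = (\<Sum>i<Z n \<omega>. \<omega> (n, i))"

text \<open>The annealed law, carried by pairs (environment, offspring numbers);
  see \<open>emeasure_annealed\<close> below.\<close>

definition annealed :: "nat pmf measure \<Rightarrow> (environment \<times> offspring) measure" where
  "annealed \<mu> = env_law \<mu> \<bind>
     (\<lambda>\<xi>. distr (quenched \<xi>) (env_law \<mu> \<Otimes>\<^sub>M offspring_space) (Pair \<xi>))"

definition pgf :: "nat pmf \<Rightarrow> real \<Rightarrow> real" where
  "pgf p s = (\<Sum>j. pmf p j * s ^ j)"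

text \<open>The inverse function is only meaningful for \<open>x\<close> in the image of \<open>[0,1]\<close>; if \<open>p\<close> has no mass at
  \<open>0\<close>, then \<open>pgf p\<close> is a bijection of \<open>[0,1]\<close>.\<close>

definition pgf_inv :: "nat pmf \<Rightarrow> real \<Rightarrow> real" where
  "pgf_inv p = inv_into {0..1} (pgf p)"

primrec f_iter :: "nat \<Rightarrow> environment \<Rightarrow> real \<Rightarrow> real" where
  "f_iter 0 \<xi> s = s"
| "f_iter (Suc n) \<xi> s = f_iter n \<xi> (pgf (\<xi> (int n)) s)"

definition y_iter :: "nat \<Rightarrow> environment \<Rightarrow> real \<Rightarrow> real" where
  "y_iter n \<xi> x = (if x = 0 then f_iter n \<xi> 0 else f_iter n \<xi> (exp (- 1 / x)))"

definition h_step :: "nat pmf \<Rightarrow> real \<Rightarrow> real" where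
  "h_step p s = - ln (pgf_inv p (exp (- s)))"

primrec h_iter :: "nat \<Rightarrow> environment \<Rightarrow> real \<Rightarrow> real" where
  "h_iter 0 \<xi> s = s"
| "h_iter (Suc n) \<xi> s = h_step (\<xi> (int n)) (h_iter n \<xi> s)"

text \<open>If no \<open>\<xi> n\<close> has mass at \<open>0\<close>, the limit \<open>d_lim \<xi> s\<close> exists for all \<open>s > 0\<close> (the quotient is
  nonincreasing in \<open>n\<close>), and the limit \<open>W \<xi> s \<omega>\<close> exists for \<open>quenched \<xi>\<close>-almost all \<open>\<omega>\<close>
  (\<open>exp (- Z n \<omega> * h_iter n \<xi> s)\<close> is a bounded martingale).\<close>

definition d_lim :: "environment \<Rightarrow> real \<Rightarrow> real" where
  "d_lim \<xi> s = lim (\<lambda>n. h_iter (Suc n) \<xi> s / h_iter n (shift \<xi>) s)"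

definition D :: "environment set" where
  "D = {\<xi>. \<forall>s>0. d_lim \<xi> s = 0}"

definition W :: "environment \<Rightarrow> real \<Rightarrow> offspring \<Rightarrow> ennreal" where
  "W \<xi> s \<omega> = lim (\<lambda>n. ennreal (real (Z n \<omega>) * h_iter n \<xi> s))"

definition regular_point :: "environment \<Rightarrow> real \<Rightarrow> bool" where
  "regular_point \<xi> s \<longleftrightarrow> s > 0 \<and> (AE \<omega> in quenched \<xi>. W \<xi> s \<omega> \<in> {0, \<infinity>})"

definition regular_env :: "environment \<Rightarrow> bool" where
  "regular_env \<xi> \<longleftrightarrow> (\<forall>s>0. regular_point \<xi> s)"

definition regular_bp :: "nat pmf measure \<Rightarrow> bool" where
  "regular_bp \<mu> \<longleftrightarrow> (AE \<xi> in env_law \<mu>. regular_env \<xi>)"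

lemma prob_space_quenched: "prob_space (quenched \<xi>)"
  unfolding quenched_def
  by (intro prob_space_PiM) (auto simp: measure_pmf.prob_space_axioms split: prod.split)

lemma sets_quenched: "sets (quenched \<xi>) = sets offspring_space"
  unfolding quenched_def offspring_space_def by (intro sets_PiM_cong) auto

lemma measure_pmf_measurable_dist_space:
  "measure_pmf \<in> dist_space \<rightarrow>\<^sub>M prob_algebra (count_space UNIV)"
  unfolding dist_space_def
  by (rule measurable_vimage_algebra1)
     (auto simp: space_prob_algebra measure_pmf.prob_space_axioms)

lemma sets_env_law:
  assumes "sets \<mu> = sets dist_space"
  shows "sets (env_law \<mu>) = sets (Pi\<^sub>M UNIV (\<lambda>_::int. dist_space))"
  unfolding env_law_def by (intro sets_PiM_cong assms refl)

lemma quenched_measurable: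
  assumes "sets \<mu> = sets dist_space"
  shows "quenched \<in> env_law \<mu> \<rightarrow>\<^sub>M prob_algebra offspring_space"
proof (rule measurable_prob_algebra_generated)
  show "sets offspring_space = sigma_sets (\<Pi>\<^sub>E i\<in>UNIV. space (count_space UNIV))
      (prod_algebra UNIV (\<lambda>_::nat \<times> nat. count_space (UNIV :: nat set)))"
    unfolding offspring_space_def by (rule sets_PiM)
  show "Int_stable (prod_algebra UNIV (\<lambda>_::nat \<times> nat. count_space (UNIV :: nat set)))"
    by (rule Int_stable_prod_algebra)
  show "prod_algebra UNIV (\<lambda>_::nat \<times> nat. count_space (UNIV :: nat set))
      \<subseteq> Pow (\<Pi>\<^sub>E i\<in>UNIV. space (count_space UNIV))"
    by (rule prod_algebra_sets_into_space)
  show "prob_space (quenched \<xi>)" for \<xi> by (rule prob_space_quenched)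
  show "sets (quenched \<xi>) = sets offspring_space" for \<xi> by (rule sets_quenched)
  fix A assume "A \<in> prod_algebra UNIV (\<lambda>_::nat \<times> nat. count_space (UNIV :: nat set))"
  then obtain J E where J: "finite J" and
    A: "A = prod_emb UNIV (\<lambda>_::nat \<times> nat. count_space (UNIV :: nat set)) J (Pi\<^sub>E J E)"
    by (elim prod_algebraE) blast
  have eq: "emeasure (quenched \<xi>) A = (\<Prod>j\<in>J. emeasure (measure_pmf (\<xi> (int (fst j)))) (E j))" for \<xi>
  proof -
    have "A = prod_emb UNIV (\<lambda>(n, i). measure_pmf (\<xi> (int n))) J (Pi\<^sub>E J E)"
      unfolding A by (simp add: prod_emb_def case_prod_unfold)
    then have "emeasure (quenched \<xi>) A
        = (\<Prod>j\<in>J. emeasure (case j of (n, i) \<Rightarrow> measure_pmf (\<xi> (int n))) (E j))"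
      unfolding quenched_def using J
      by (simp only:) (rule emeasure_PiM_emb,
          auto simp: measure_pmf.prob_space_axioms split: prod.split)
    then show ?thesis by (simp add: case_prod_unfold)
  qed
  have "(\<lambda>\<xi>. emeasure (measure_pmf (\<xi> (int (fst j)))) (E j)) \<in> borel_measurable (env_law \<mu>)" for j
  proof -
    have 1: "(\<lambda>\<xi>. \<xi> (int (fst j))) \<in> env_law \<mu> \<rightarrow>\<^sub>M dist_space"
      unfolding measurable_cong_sets[OF sets_env_law[OF assms] refl] by measurable
    have 2: "(\<lambda>p. emeasure (measure_pmf p) (E j)) \<in> borel_measurable dist_space"
      by (rule measurable_compose[OF measure_pmf_measurable_dist_space[THEN measurable_prob_algebraD]
            measurable_emeasure_subprob_algebra]) simp
    show ?thesis using measurable_compose[OF 1 2] .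
  qed
  then show "(\<lambda>\<xi>. emeasure (quenched \<xi>) A) \<in> borel_measurable (env_law \<mu>)"
    unfolding eq by (intro borel_measurable_prod_ennreal)
qed

lemma annealed_kernel_measurable:
  assumes "sets \<mu> = sets dist_space"
  shows "(\<lambda>\<xi>. distr (quenched \<xi>) (env_law \<mu> \<Otimes>\<^sub>M offspring_space) (Pair \<xi>))
    \<in> env_law \<mu> \<rightarrow>\<^sub>M prob_algebra (env_law \<mu> \<Otimes>\<^sub>M offspring_space)"
  by (rule measurable_distr_prob_space2[OF quenched_measurable[OF assms]]) simp

lemma env_law_prob_algebra:
  assumes "prob_space \<mu>"
  shows "env_law \<mu> \<in> space (prob_algebra (env_law \<mu>))"
  using assms by (auto simp: space_prob_algebra env_law_def intro!: prob_space_PiM)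

lemma prob_space_annealed:
  assumes "prob_space \<mu>" "sets \<mu> = sets dist_space"
  shows "prob_space (annealed \<mu>)"
  unfolding annealed_def
  by (rule prob_space_bind'[OF env_law_prob_algebra annealed_kernel_measurable]) fact+

lemma sets_annealed:
  assumes "prob_space \<mu>" "sets \<mu> = sets dist_space"
  shows "sets (annealed \<mu>) = sets (env_law \<mu> \<Otimes>\<^sub>M offspring_space)"
  unfolding annealed_def
  by (rule sets_bind'[OF env_law_prob_algebra annealed_kernel_measurable]) fact+

lemma emeasure_annealed:
  assumes "prob_space \<mu>" "sets \<mu> = sets dist_space"
    and A: "A \<in> sets (env_law \<mu> \<Otimes>\<^sub>M offspring_space)"
  shows "emeasure (annealed \<mu>) A = (\<integral>\<^sup>+\<xi>. emeasure (quenched \<xi>) {\<omega>. (\<xi>, \<omega>) \<in> A} \<partial>env_law \<mu>)"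
proof -
  have "emeasure (annealed \<mu>) A = (\<integral>\<^sup>+\<xi>. emeasure
      (distr (quenched \<xi>) (env_law \<mu> \<Otimes>\<^sub>M offspring_space) (Pair \<xi>)) A \<partial>env_law \<mu>)"
    unfolding annealed_def
    by (rule emeasure_bind_prob_algebra[OF env_law_prob_algebra annealed_kernel_measurable A]) fact+
  also have "\<dots> = (\<integral>\<^sup>+\<xi>. emeasure (quenched \<xi>) {\<omega>. (\<xi>, \<omega>) \<in> A} \<partial>env_law \<mu>)"
  proof (rule nn_integral_cong)
    fix \<xi> assume \<xi>: "\<xi> \<in> space (env_law \<mu>)"
    have "Pair \<xi> \<in> quenched \<xi> \<rightarrow>\<^sub>M env_law \<mu> \<Otimes>\<^sub>M offspring_space"
      unfolding measurable_cong_sets[OF sets_quenched refl] by (rule measurable_Pair1'[OF \<xi>])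
    moreover have "space (quenched \<xi>) = UNIV"
      unfolding sets_eq_imp_space_eq[OF sets_quenched]
      by (simp add: offspring_space_def space_PiM)
    ultimately show "emeasure (distr (quenched \<xi>) (env_law \<mu> \<Otimes>\<^sub>M offspring_space) (Pair \<xi>)) A
        = emeasure (quenched \<xi>) {\<omega>. (\<xi>, \<omega>) \<in> A}"
      by (simp add: emeasure_distr[OF _ A] vimage_def)
  qed
  finally show ?thesis .
qed

end

(* Solving y_n(Z_n) <= exp (-s) for Z_n turns it into exp (- Z_n h_n(s)) >= exp (-1), so the behaviour
   of y_n(Z_n) is governed by the martingales exp (- Z_n h_n(s)). They are bounded, hence converge
   a.s. to L(s) = exp (- W(s)), with expectation exp (-s).  By Jensen's inequality
   h_n(t) >= (t/s) h_n(s) for s < t, so L(t) <= L(s) powr (t/s) and exp (- 1) can be the value of at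
   most one L(s); this forces y_n(Z_n) to converge.  Since L is decreasing in s and its expectation
   is continuous with limits 1 and 0, the limit Y has no mass at 0, at 1 and at exp (-s) for regular
   s, and for regular s the events Y <= exp (-s) and L(s) = 1 coincide a.s. *)
theory Submission
  imports Defs
begin

section \<open>Probability generating functions without mass at zero\<close>

text \<open>The constant \<open>exp (- 1)\<close> comes from the argument e^(-1/x) in the definition
  of y_n: comparing it at x = Z_n with e^(-h_n(s)) amounts to comparing Z_n h_n(s) with 1. The
  exponential turns the possibly infinite limit W into a variable with values in [0,1], so that
  expectations pass to the limit. The obstacle is that each almost sure statement is obtained for
  one s at a time, with an exceptional set depending on s. Hence L is never treated as a random
  function of s. Convergence of y_n(Z_n) uses rational s and t only, and pathwise continuity of L is
  replaced by Markov's inequality for L(s) - L(t), whose mean exp (-s) - exp (-t) is small for t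
  near s. The environment stays fixed until the last section, where measurability in it is needed to
  reach the annealed law.\<close>

lemma pgf_eq_expectation:
  assumes "0 \<le> s" "s \<le> 1"
  shows "pgf p s = measure_pmf.expectation p (\<lambda>j. s ^ j)"
proof -
  have bounded: "integrable (measure_pmf p) (\<lambda>j. s ^ j)"
    using assms by (intro measure_pmf.integrable_const_bound[where B = 1]) (auto simp: power_le_one)
  have "integrable (density (count_space UNIV) (pmf p)) (\<lambda>j. s ^ j)"
    using bounded unfolding measure_pmf_eq_density .
  then have "integrable (count_space UNIV) (\<lambda>j. pmf p j * s ^ j)"
    by (subst (asm) integrable_density) auto
  then have "(\<integral>j. pmf p j * s ^ j \<partial>count_space UNIV) = (\<Sum>j. pmf p j * s ^ j)"
    by (intro sums_unique sums_integral_count_space_nat)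
  then show ?thesis
    unfolding pgf_def measure_pmf_eq_density by (subst integral_density) auto
qed

lemma integrable_power_pmf [simp]:
  fixes s :: real
  assumes "0 \<le> s" "s \<le> 1"
  shows "integrable (measure_pmf p) (\<lambda>j. s ^ j)"
  using assms by (intro measure_pmf.integrable_const_bound[where B = 1]) (auto simp: power_le_one)

lemma pgf_0: "pmf p 0 = 0 \<Longrightarrow> pgf p 0 = 0"
  unfolding pgf_def by (subst suminf_finite[of "{0}"]) auto

lemma pgf_1: "pgf p 1 = 1"
  by (simp add: pgf_eq_expectation)

lemma AE_pmf_pos: "pmf p 0 = 0 \<Longrightarrow> AE j in measure_pmf p. 0 < (j::nat)"
  by (auto simp: AE_measure_pmf_iff set_pmf_iff intro: gr0I)

text \<open>Every atom of \<open>p\<close> is a positive integer, and for positive \<open>j\<close>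
  the power \<open>s ^ j\<close> is strictly increasing in \<open>s\<close>; only at
  \<open>j = 0\<close> would the two powers tie.\<close>

lemma pgf_strict_mono_on:
  assumes "pmf p 0 = 0"
  shows "strict_mono_on {0..1} (pgf p)"
proof (rule strict_mono_onI)
  fix s t :: real
  assume st: "s \<in> {0..1}" "t \<in> {0..1}" "s < t"
  have "measure_pmf.expectation p (\<lambda>j. s ^ j) < measure_pmf.expectation p (\<lambda>j. t ^ j)"
  proof (rule measure_pmf.integral_less_AE_space)
    show "AE j in measure_pmf p. s ^ j < t ^ j"
      using AE_pmf_pos[OF assms] by eventually_elim (use st in \<open>auto intro: power_strict_mono\<close>)
  qed (use st in auto)
  then show "pgf p s < pgf p t"
    using st by (simp add: pgf_eq_expectation)
qed

text \<open>Dominated convergence with the bound 1 includes the endpoint 1, which may lie on the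
  boundary of the disc of convergence of the power series.\<close>

lemma continuous_on_pgf: "continuous_on {0..1} (pgf p)"
proof (rule continuous_on_sequentiallyI)
  fix u :: "nat \<Rightarrow> real" and a
  assume u: "\<forall>n. u n \<in> {0..1}" "a \<in> {0..1}" "u \<longlonglongrightarrow> a"
  have "(\<lambda>n. measure_pmf.expectation p (\<lambda>j. u n ^ j)) \<longlonglongrightarrow> measure_pmf.expectation p (\<lambda>j. a ^ j)"
  proof (rule integral_dominated_convergence[where w = "\<lambda>_. 1"])
    show "AE j in measure_pmf p. (\<lambda>n. u n ^ j) \<longlonglongrightarrow> a ^ j"
      using u(3) by (auto intro: tendsto_power)
    show "AE j in measure_pmf p. norm (u n ^ j) \<le> 1" for n
      using u(1) by (auto simp: power_le_one)
  qed auto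
  then show "(\<lambda>n. pgf p (u n)) \<longlonglongrightarrow> pgf p a"
    using u by (simp add: pgf_eq_expectation)
qed

lemma bij_betw_pgf:
  assumes "pmf p 0 = 0"
  shows "bij_betw (pgf p) {0..1} {0..1}"
  unfolding bij_betw_def
proof
  show "inj_on (pgf p) {0..1}"
    by (rule strict_mono_on_imp_inj_on[OF pgf_strict_mono_on[OF assms]])
  have "pgf p s \<in> {0..1}" if "s \<in> {0..1}" for s
    using monotone_onD[OF strict_mono_on_imp_mono_on[OF pgf_strict_mono_on[OF assms]], of 0 s]
      monotone_onD[OF strict_mono_on_imp_mono_on[OF pgf_strict_mono_on[OF assms]], of s 1] that
    by (auto simp: pgf_0[OF assms] pgf_1)
  moreover have "\<exists>s\<in>{0..1}. pgf p s = y" if "y \<in> {0..1}" for y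
    using IVT'[of "pgf p" 0 y 1] that continuous_on_pgf[of p]
    by (force simp: pgf_0[OF assms] pgf_1)
  ultimately show "pgf p ` {0..1} = {0..1}"
    by (force simp: image_iff)
qed

lemma pgf_pos_less_1:
  assumes "pmf p 0 = 0" "0 < s" "s < 1"
  shows "0 < pgf p s" "pgf p s < 1"
  using strict_mono_onD[OF pgf_strict_mono_on[OF assms(1)], of 0 s]
    strict_mono_onD[OF pgf_strict_mono_on[OF assms(1)], of s 1] assms
  by (auto simp: pgf_0 pgf_1)

text \<open>Jensen's inequality for the convex function x ^ c and the random variable
  \<open>s ^ j\<close>, followed by \<open>(s ^ j) powr c = (s powr c) ^ j\<close>. Positivity of
  \<open>s\<close> keeps the values in the open half-line on which Jensen is applied.\<close>

lemma powr_pgf_le: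
  assumes "0 < s" "s \<le> 1" "1 \<le> c"
  shows "pgf p s powr c \<le> pgf p (s powr c)"
proof -
  have s: "s powr c \<le> 1"
    using assms by (simp add: powr_le1)
  have eq: "(s ^ j) powr c = (s powr c) ^ j" for j
    using assms by (simp add: powr_realpow[symmetric] powr_powr mult.commute)
  have "measure_pmf.expectation p (\<lambda>j. s ^ j) powr c \<le> measure_pmf.expectation p (\<lambda>j. (s ^ j) powr c)"
    by (rule measure_pmf.jensens_inequality[where I = "{0<..}" and a = 0])
       (use assms s in \<open>auto simp: eq intro: powr_convex\<close>)
  then show ?thesis
    using assms s by (simp add: pgf_eq_expectation eq)
qed

section \<open>The inverse generating function in logarithmic coordinates\<close>

lemma pgf_pgf_inv:
  assumes "pmf p 0 = 0" "0 \<le> x" "x \<le> 1"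
  shows "pgf p (pgf_inv p x) = x" "0 \<le> pgf_inv p x" "pgf_inv p x \<le> 1"
proof -
  have "x \<in> pgf p ` {0..1}"
    using bij_betw_imp_surj_on[OF bij_betw_pgf[OF assms(1)]] assms by auto
  from f_inv_into_f[OF this] inv_into_into[OF this]
  show "pgf p (pgf_inv p x) = x" "0 \<le> pgf_inv p x" "pgf_inv p x \<le> 1"
    by (auto simp: pgf_inv_def)
qed

lemma pgf_exp_h_step:
  assumes "pmf p 0 = 0" "0 \<le> u"
  shows "0 \<le> h_step p u" "pgf p (exp (- h_step p u)) = exp (- u)"
proof -
  let ?x = "pgf_inv p (exp (- u))"
  note x = pgf_pgf_inv[OF assms(1), of "exp (- u)"]
  \<comment> \<open>\<open>exp\<close> undoes \<open>ln\<close> only at positive numbers, so the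
    value 0 of the inverse has to be excluded before the definition of \<open>h_step\<close> can be
    used.\<close>
  have "?x \<noteq> 0"
    using x(1) pgf_0[OF assms(1)] assms(2) by auto
  then have x': "0 < ?x" "?x \<le> 1"
    using x(2,3) assms(2) by auto
  then have "exp (- h_step p u) = ?x"
    by (simp add: h_step_def)
  then show "pgf p (exp (- h_step p u)) = exp (- u)"
    using x(1) assms(2) by simp
  show "0 \<le> h_step p u"
    using x' by (simp add: h_step_def)
qed

lemma pgf_less_iff:
  assumes "pmf p 0 = 0" "s \<in> {0..1}" "t \<in> {0..1}"
  shows "pgf p s < pgf p t \<longleftrightarrow> s < t"
  using strict_mono_on_less[OF pgf_strict_mono_on[OF assms(1)]] assms by auto

lemma h_step_mono:
  assumes "pmf p 0 = 0" "0 \<le> u" "u \<le> v"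
  shows "h_step p u \<le> h_step p v"
proof (rule ccontr)
  assume "\<not> h_step p u \<le> h_step p v"
  then have "exp (- h_step p u) < exp (- h_step p v)"
    by simp
  then have "exp (- u) < exp (- v)"
    using pgf_less_iff[OF assms(1), of "exp (- h_step p u)" "exp (- h_step p v)"]
      pgf_exp_h_step[OF assms(1)] assms by auto
  then show False
    using assms by simp
qed

text \<open>This is \<open>powr_pgf_le\<close> at the point \<open>exp (- h_step p u)\<close>, read
  in logarithmic coordinates: the power becomes the factor \<open>c\<close>, and monotonicity of
  \<open>pgf p\<close> transfers the inequality to the arguments.\<close>

lemma mult_h_step_le:
  assumes "pmf p 0 = 0" "0 \<le> u" "1 \<le> c"
  shows "c * h_step p u \<le> h_step p (c * u)"
proof (rule ccontr)
  assume "\<not> c * h_step p u \<le> h_step p (c * u)"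
  then have less: "exp (- (c * h_step p u)) < exp (- h_step p (c * u))"
    by simp
  have "0 \<le> c * h_step p u"
    using pgf_exp_h_step[OF assms(1,2)] assms(3) by simp
  with less have "pgf p (exp (- (c * h_step p u))) < exp (- (c * u))"
    using pgf_less_iff[OF assms(1), of "exp (- (c * h_step p u))" "exp (- h_step p (c * u))"]
      pgf_exp_h_step[OF assms(1), of "c * u"] assms by auto
  moreover have "exp (- (c * u)) \<le> pgf p (exp (- (c * h_step p u)))"
    using powr_pgf_le[of "exp (- h_step p u)" c p] pgf_exp_h_step[OF assms(1,2)] assms(3)
    by (simp add: powr_def mult.commute)
  ultimately show False
    by simp
qed

section \<open>Iterated maps along one environment\<close>

definition no_extinction :: "environment \<Rightarrow> bool" where
  "no_extinction \<xi> \<longleftrightarrow> (\<forall>n::nat. pmf (\<xi> (int n)) 0 = 0)"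

lemma h_iter_nonneg: "no_extinction \<xi> \<Longrightarrow> 0 \<le> s \<Longrightarrow> 0 \<le> h_iter n \<xi> s"
  by (induction n) (auto simp: no_extinction_def intro: pgf_exp_h_step)

text \<open>The point 1 = e^0 is fixed by every generating function. This makes the martingale at
  \<open>s = 0\<close> constant, which later excludes the limit value 1.\<close>

lemma h_iter_0: "h_iter n \<xi> 0 = 0" if "no_extinction \<xi>"
proof (induction n)
  case (Suc n)
  have p: "pmf (\<xi> (int n)) 0 = 0"
    using that by (simp add: no_extinction_def)
  have "\<not> exp (- h_step (\<xi> (int n)) 0) < 1"
    using pgf_less_iff[OF p, of "exp (- h_step (\<xi> (int n)) 0)" 1] pgf_exp_h_step[OF p, of 0]
    by (auto simp: pgf_1)
  then show ?case
    using Suc pgf_exp_h_step(1)[OF p, of 0] by auto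
qed simp

lemma h_iter_mono:
  assumes "no_extinction \<xi>" "0 \<le> s" "s \<le> t"
  shows "h_iter n \<xi> s \<le> h_iter n \<xi> t"
proof (induction n)
  case (Suc n)
  then show ?case
    using assms h_iter_nonneg[OF assms(1,2)] by (auto simp: no_extinction_def intro: h_step_mono)
qed (use assms in simp)

text \<open>Superlinearity survives composition because each \<open>h_step\<close> is monotone as
  well.\<close>

lemma mult_h_iter_le:
  assumes "no_extinction \<xi>" "0 \<le> s" "1 \<le> c"
  shows "c * h_iter n \<xi> s \<le> h_iter n \<xi> (c * s)"
proof (induction n)
  case (Suc n)
  have p: "pmf (\<xi> (int n)) 0 = 0"
    using assms by (simp add: no_extinction_def)
  have "c * h_step (\<xi> (int n)) (h_iter n \<xi> s) \<le> h_step (\<xi> (int n)) (c * h_iter n \<xi> s)"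
    by (intro mult_h_step_le p assms h_iter_nonneg)
  also have "\<dots> \<le> h_step (\<xi> (int n)) (h_iter n \<xi> (c * s))"
    using Suc assms h_iter_nonneg[OF assms(1,2)] by (intro h_step_mono p) auto
  finally show ?case
    by simp
qed simp

lemma f_iter_strict_mono_on:
  assumes "no_extinction \<xi>"
  shows "strict_mono_on {0..1} (f_iter n \<xi>)"
proof (induction n)
  case (Suc n)
  have p: "pmf (\<xi> (int n)) 0 = 0"
    using assms by (simp add: no_extinction_def)
  have "pgf (\<xi> (int n)) r \<in> {0..1}" if "r \<in> {0..1}" for r
    using bij_betwE[OF bij_betw_pgf[OF p]] that by blast
  then show ?case
    using strict_mono_onD[OF Suc] strict_mono_onD[OF pgf_strict_mono_on[OF p]]
    by (auto intro!: strict_mono_onI simp del: atLeastAtMost_iff)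
qed (simp add: strict_mono_on_def)

lemma f_iter_range:
  assumes "no_extinction \<xi>" "0 < s" "s < 1"
  shows "f_iter n \<xi> s \<in> {0<..<1}"
  using assms(2,3)
proof (induction n arbitrary: s)
  case (Suc n)
  have p: "pmf (\<xi> (int n)) 0 = 0"
    using assms by (simp add: no_extinction_def)
  show ?case
    using Suc.IH[OF pgf_pos_less_1[OF p Suc.prems]] by simp
qed simp

text \<open>Coordinate \<open>n\<close> enters \<open>f_iter\<close> as the innermost map and
  \<open>h_iter\<close> as the outermost one, so these two layers cancel first and the rest is the
  induction hypothesis.\<close>

lemma f_iter_exp_h_iter:
  assumes "no_extinction \<xi>" "0 \<le> s"
  shows "f_iter n \<xi> (exp (- h_iter n \<xi> s)) = exp (- s)"
proof (induction n)
  case (Suc n)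
  then show ?case
    using assms h_iter_nonneg[OF assms, of n] by (auto simp: no_extinction_def pgf_exp_h_step)
qed simp

lemma y_iter_le_iff:
  assumes "no_extinction \<xi>" "0 \<le> s" "0 < z"
  shows "y_iter n \<xi> z \<le> exp (- s) \<longleftrightarrow> exp (- 1) \<le> exp (- (z * h_iter n \<xi> s))"
proof -
  have "y_iter n \<xi> z \<le> exp (- s) \<longleftrightarrow> f_iter n \<xi> (exp (- 1 / z)) \<le> f_iter n \<xi> (exp (- h_iter n \<xi> s))"
    using assms by (simp add: y_iter_def f_iter_exp_h_iter)
  also have "\<dots> \<longleftrightarrow> exp (- 1 / z) \<le> exp (- h_iter n \<xi> s)"
    using strict_mono_on_less_eq[OF f_iter_strict_mono_on[OF assms(1)]] h_iter_nonneg[OF assms(1,2)] assms(3)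
    by auto
  also have "\<dots> \<longleftrightarrow> exp (- 1) \<le> exp (- (z * h_iter n \<xi> s))"
    using assms(3) by (simp add: field_simps)
  finally show ?thesis .
qed

lemma y_iter_range:
  assumes "no_extinction \<xi>" "0 < z"
  shows "y_iter n \<xi> z \<in> {0<..<1}"
  using f_iter_range[OF assms(1)] assms(2) by (simp add: y_iter_def)

section \<open>Convergence of bounded martingales\<close>

context prob_space
begin

context
  fixes X :: "nat \<Rightarrow> 'a \<Rightarrow> real" and F :: "nat \<Rightarrow> 'a measure" and B :: real
  assumes sub: "\<And>n. subalgebra M (F n)"
    and mono: "\<And>n. subalgebra (F (Suc n)) (F n)"
    and adapted: "\<And>n. X n \<in> borel_measurable (F n)"
    and bounded: "\<And>n x. x \<in> space M \<Longrightarrow> \<bar>X n x\<bar> \<le> B"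
    and martingale: "\<And>n. AE x in M. real_cond_exp M (F n) (X (Suc n)) x = X n x"
begin

lemma adapted_le: "n \<le> m \<Longrightarrow> g \<in> borel_measurable (F n) \<Longrightarrow> g \<in> borel_measurable (F m)"
  by (induction rule: dec_induct) (auto intro: measurable_from_subalg[OF mono])

lemma martingale_measurable: "X n \<in> borel_measurable M"
  by (rule measurable_from_subalg[OF sub adapted])

lemma martingale_bound_nonneg: "0 \<le> B"
  using not_empty bounded[of _ 0] by (meson abs_ge_zero order_trans ex_in_conv)

lemma integrable_bounded_mult:
  assumes [measurable]: "g \<in> borel_measurable M" "h \<in> borel_measurable M"
    and "\<And>x. x \<in> space M \<Longrightarrow> \<bar>g x\<bar> \<le> C" "\<And>x. x \<in> space M \<Longrightarrow> \<bar>h x\<bar> \<le> C'"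
  shows "integrable M (\<lambda>x. g x * h x :: real)"
proof (rule integrable_const_bound[where B = "C * C'"])
  show "AE x in M. norm (g x * h x) \<le> C * C'"
    using assms(3,4) by (intro AE_I2) (force simp: abs_mult intro!: mult_mono elim: order_trans[OF abs_ge_zero])
qed measurable

text \<open>An integrated tower property: the bounded factor \<open>g\<close> stays measurable for
  every later \<open>F m\<close>, so it can be carried through one conditional expectation per
  step.\<close>

lemma martingale_integral_eq:
  assumes "n \<le> m" "g \<in> borel_measurable (F n)" "\<And>x. x \<in> space M \<Longrightarrow> \<bar>g x\<bar> \<le> C"
  shows "(\<integral>x. g x * X m x \<partial>M) = (\<integral>x. g x * X n x \<partial>M)"
  using assms(1)
proof (induction rule: dec_induct)
  case (step m)
  note [measurable] = martingale_measurable
  interpret finite_measure_subalgebra M "F m"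
    by unfold_locales (rule sub)
  have [measurable]: "g \<in> borel_measurable (F m)"
    by (rule adapted_le[OF step.hyps(1) assms(2)])
  have [measurable]: "g \<in> borel_measurable M"
    by (rule measurable_from_subalg[OF sub assms(2)])
  have "(\<integral>x. g x * X (Suc m) x \<partial>M) = (\<integral>x. g x * real_cond_exp M (F m) (X (Suc m)) x \<partial>M)"
    by (rule real_cond_exp_intg(2)[symmetric])
       (auto intro: integrable_bounded_mult[OF _ _ assms(3) bounded])
  also have "\<dots> = (\<integral>x. g x * X m x \<partial>M)"
  proof (rule integral_cong_AE)
    show "AE x in M. g x * real_cond_exp M (F m) (X (Suc m)) x = g x * X m x"
      using martingale[of m] by eventually_elim simp
  qed measurable
  finally show ?case
    using step.IH by simp
qed simp

lemma martingale_increment_orthogonal: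
  assumes "k \<le> m" "g \<in> borel_measurable (F k)" "\<And>x. x \<in> space M \<Longrightarrow> \<bar>g x\<bar> \<le> C"
  shows "(\<integral>x. g x * (X m x - X k x) \<partial>M) = 0"
proof -
  note [measurable] = martingale_measurable
  have [measurable]: "g \<in> borel_measurable M"
    by (rule measurable_from_subalg[OF sub assms(2)])
  have "integrable M (\<lambda>x. g x * X j x)" for j
    by (rule integrable_bounded_mult[OF _ _ assms(3) bounded]) auto
  then show ?thesis
    using martingale_integral_eq[OF assms] by (simp add: right_diff_distrib)
qed

lemma integrable_increment_sq:
  "integrable M (\<lambda>x. (X m x - X n x)\<^sup>2)"
proof -
  note [measurable] = martingale_measurable
  have "\<bar>X m x - X n x\<bar> \<le> 2 * B" if "x \<in> space M" for x
    using bounded[OF that, of m] bounded[OF that, of n] by simp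
  then show ?thesis
    unfolding power2_eq_square by (intro integrable_bounded_mult[where C = "2 * B" and C' = "2 * B"]) auto
qed

text \<open>Pythagoras in L2: the increment after time \<open>n\<close> is orthogonal to
  \<open>X n\<close>. In particular the second moments increase with time.\<close>

lemma integral_increment_sq:
  assumes "n \<le> m"
  shows "(\<integral>x. (X m x - X n x)\<^sup>2 \<partial>M) = (\<integral>x. (X m x)\<^sup>2 \<partial>M) - (\<integral>x. (X n x)\<^sup>2 \<partial>M)"
proof -
  note [measurable] = martingale_measurable
  have int: "integrable M (\<lambda>x. X i x * X j x)" for i j
    by (rule integrable_bounded_mult[OF _ _ bounded bounded]) auto
  have "(\<integral>x. (X m x - X n x)\<^sup>2 \<partial>M)
      = (\<integral>x. X m x * X m x - X n x * X n x - 2 * (X n x * (X m x - X n x)) \<partial>M)"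
    by (intro Bochner_Integration.integral_cong) (auto simp: power2_eq_square algebra_simps)
  also have "\<dots> = (\<integral>x. X m x * X m x \<partial>M) - (\<integral>x. X n x * X n x \<partial>M) - 2 * (\<integral>x. X n x * (X m x - X n x) \<partial>M)"
    using int by (simp add: right_diff_distrib)
  also have "(\<integral>x. X n x * (X m x - X n x) \<partial>M) = 0"
    by (rule martingale_increment_orthogonal[OF assms adapted bounded])
  finally show ?thesis
    by (simp add: power2_eq_square)
qed

text \<open>The events \<open>A k\<close> that \<open>k\<close> is the first time after \<open>n\<close> at which the increment exceeds \<open>e\<close>
  are disjoint, and on \<open>A k\<close> the later increment \<open>X m - X k\<close> is orthogonal to \<open>X k - X n\<close>.\<close>

lemma maximal_inequality:
  assumes "n \<le> m" "0 < e"
  shows "prob {x \<in> space M. \<exists>k\<in>{n..m}. e \<le> \<bar>X k x - X n x\<bar>} \<le> (\<integral>x. (X m x - X n x)\<^sup>2 \<partial>M) / e\<^sup>2"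
proof -
  note [measurable] = martingale_measurable
  define A where "A k = {x \<in> space M. e \<le> \<bar>X k x - X n x\<bar> \<and> (\<forall>j\<in>{n..<k}. \<bar>X j x - X n x\<bar> < e)}" for k
  \<comment> \<open>The event must be known at time \<open>k\<close>, not merely measurable, because
    orthogonality to \<open>X m - X k\<close> is available only for factors measurable with respect
    to \<open>F k\<close>.\<close>
  have A_F: "A k \<in> sets (F k)" if "n \<le> k" for k
  proof -
    have [measurable]: "X j \<in> borel_measurable (F k)" if "j \<le> k" for j
      using adapted_le[OF that adapted] .
    have "space M = space (F k)"
      using sub[of k] by (simp add: subalgebra_def)
    moreover have "{x \<in> space (F k). e \<le> \<bar>X k x - X n x\<bar> \<and> (\<forall>j\<in>{n..<k}. \<bar>X j x - X n x\<bar> < e)} \<in> sets (F k)"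
    proof (intro sets.sets_Collect_conj sets.sets_Collect_finite_All)
      show "{x \<in> space (F k). e \<le> \<bar>X k x - X n x\<bar>} \<in> sets (F k)"
        using that by measurable
      show "{x \<in> space (F k). \<bar>X j x - X n x\<bar> < e} \<in> sets (F k)" if "j \<in> {n..<k}" for j
      proof -
        have [measurable]: "X j \<in> borel_measurable (F k)" "X n \<in> borel_measurable (F k)"
          using that by (auto intro!: adapted_le[OF _ adapted])
        show ?thesis
          by measurable
      qed
    qed simp
    ultimately show ?thesis
      by (simp add: A_def)
  qed
  have A_M [measurable]: "A k \<in> sets M" if "n \<le> k" for k
    using A_F[OF that] sub[of k] by (auto simp: subalgebra_def)
  have disj: "disjoint_family_on A {n..m}"
    by (auto simp: disjoint_family_on_def A_def set_eq_iff)
      (metis atLeastLessThan_iff linorder_neqE_nat not_less)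
  have UN: "{x \<in> space M. \<exists>k\<in>{n..m}. e \<le> \<bar>X k x - X n x\<bar>} = (\<Union>k\<in>{n..m}. A k)"
  proof safe
    fix x k assume "x \<in> space M" "k \<in> {n..m}" "e \<le> \<bar>X k x - X n x\<bar>"
    then show "x \<in> (\<Union>k\<in>{n..m}. A k)"
    \<comment> \<open>Descending to an earlier exceedance as long as there is one ends at the first
      exceedance time.\<close>
    proof (induction k rule: less_induct)
      case (less k)
      show ?case
      proof (cases "\<exists>j\<in>{n..<k}. e \<le> \<bar>X j x - X n x\<bar>")
        case True
        then show ?thesis
          using less by fastforce
      next
        case False
        then have "x \<in> A k"
          using less by (auto simp: A_def not_le)
        then show ?thesis
          using less by blast
      qed
    qed
  qed (auto simp: A_def)
  have le: "e\<^sup>2 * prob (A k) \<le> (\<integral>x. indicator (A k) x * (X m x - X n x)\<^sup>2 \<partial>M)" if k: "k \<in> {n..m}" for k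
  proof -
    have [measurable]: "A k \<in> sets M"
      using k by auto
    define g where "g x = indicator (A k) x * (X k x - X n x)" for x
    have g_le: "\<bar>g x\<bar> \<le> 2 * B" if "x \<in> space M" for x
      using bounded[OF that, of k] bounded[OF that, of n] by (auto simp: g_def indicator_def)
    have g_F: "g \<in> borel_measurable (F k)"
      unfolding g_def using A_F[of k] adapted[of k] adapted_le[OF _ adapted, of n k] k by auto
    have [measurable]: "g \<in> borel_measurable M"
      unfolding g_def by measurable
    have int: "integrable M (\<lambda>x. indicator (A k) x * (X i x - X j x)\<^sup>2)" for i j
      using integrable_mult_indicator[OF _ integrable_increment_sq[of i j], of "A k"] by simp
    have int_g: "integrable M (\<lambda>x. g x * (X m x - X k x))"
    proof -
      have "integrable M (\<lambda>x. g x * X j x)" for j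
        by (rule integrable_bounded_mult[OF _ _ g_le bounded]) auto
      then show ?thesis
        by (simp add: right_diff_distrib)
    qed
    have "e\<^sup>2 * prob (A k) = (\<integral>x. indicator (A k) x * e\<^sup>2 \<partial>M)"
      by simp
    \<comment> \<open>Twice the cross term is added under the integral and subtracted outside, where
      it will turn out to be 0; the integrand then becomes the full square of
      \<open>X m - X n\<close> on \<open>A k\<close>.\<close>
    also have "\<dots> \<le> (\<integral>x. indicator (A k) x * (X k x - X n x)\<^sup>2 + 2 * (g x * (X m x - X k x))
        + indicator (A k) x * (X m x - X k x)\<^sup>2 \<partial>M) - 2 * (\<integral>x. g x * (X m x - X k x) \<partial>M)"
    proof -
      have "(\<integral>x. indicator (A k) x * e\<^sup>2 \<partial>M) \<le> (\<integral>x. indicator (A k) x * (X k x - X n x)\<^sup>2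
        + indicator (A k) x * (X m x - X k x)\<^sup>2 \<partial>M)"
      proof (rule integral_mono)
        fix x
        have "e\<^sup>2 \<le> (X k x - X n x)\<^sup>2" if "x \<in> A k"
          using that assms(2) by (auto simp: A_def abs_le_square_iff[symmetric])
        then show "indicator (A k) x * e\<^sup>2 \<le> indicator (A k) x * (X k x - X n x)\<^sup>2
          + indicator (A k) x * (X m x - X k x)\<^sup>2"
          by (auto simp: indicator_def intro: add_increasing2)
      next
        have "integrable M (\<lambda>x. indicat_real (A k) x *\<^sub>R e\<^sup>2)"
          by (intro integrable_indicator) (auto simp: less_top[symmetric])
        then show "integrable M (\<lambda>x. indicat_real (A k) x * e\<^sup>2)"
          by simp
      qed (use int in auto)
      also have "\<dots> = (\<integral>x. indicator (A k) x * (X k x - X n x)\<^sup>2 + 2 * (g x * (X m x - X k x))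
        + indicator (A k) x * (X m x - X k x)\<^sup>2 \<partial>M) - 2 * (\<integral>x. g x * (X m x - X k x) \<partial>M)"
        using int int_g by simp
      finally show ?thesis .
    qed
    also have "(\<lambda>x. indicator (A k) x * (X k x - X n x)\<^sup>2 + 2 * (g x * (X m x - X k x))
        + indicator (A k) x * (X m x - X k x)\<^sup>2) = (\<lambda>x. indicator (A k) x * (X m x - X n x)\<^sup>2)"
      by (auto simp: g_def fun_eq_iff indicator_def power2_eq_square algebra_simps)
    also have "(\<integral>x. g x * (X m x - X k x) \<partial>M) = 0"
      using k by (intro martingale_increment_orthogonal[OF _ g_F g_le]) auto
    finally show ?thesis
      by simp
  qed
  have int_A: "integrable M (\<lambda>x. indicator (A k) x * (X m x - X n x)\<^sup>2)" if "k \<in> {n..m}" for k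
    using integrable_mult_indicator[OF _ integrable_increment_sq[of m n], of "A k"] that by simp
  have "e\<^sup>2 * prob (\<Union>k\<in>{n..m}. A k) = (\<Sum>k\<in>{n..m}. e\<^sup>2 * prob (A k))"
    using disj by (subst finite_measure_finite_Union) (auto simp: sum_distrib_left)
  also have "\<dots> \<le> (\<Sum>k\<in>{n..m}. \<integral>x. indicator (A k) x * (X m x - X n x)\<^sup>2 \<partial>M)"
    by (intro sum_mono le)
  also have "\<dots> = (\<integral>x. (\<Sum>k\<in>{n..m}. indicator (A k) x * (X m x - X n x)\<^sup>2) \<partial>M)"
    using int_A by (subst Bochner_Integration.integral_sum) auto
  also have "\<dots> \<le> (\<integral>x. (X m x - X n x)\<^sup>2 \<partial>M)"
  proof (rule integral_mono)
    fix x
    have "(\<Sum>k\<in>{n..m}. indicat_real (A k) x) = indicator (\<Union>k\<in>{n..m}. A k) x"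
      using disj by (simp add: indicator_UN_disjoint)
    then show "(\<Sum>k\<in>{n..m}. indicator (A k) x * (X m x - X n x)\<^sup>2) \<le> (X m x - X n x)\<^sup>2"
      by (simp add: sum_distrib_right[symmetric] mult_left_le_one_le)
  next
    show "integrable M (\<lambda>x. \<Sum>k\<in>{n..m}. indicator (A k) x * (X m x - X n x)\<^sup>2)"
      by (intro Bochner_Integration.integrable_sum int_A)
  qed (rule integrable_increment_sq)
  finally show ?thesis
    using assms(2) by (simp add: UN field_simps)
qed

text \<open>The second moments \<open>a n\<close> increase and are at most \<open>B\<^sup>2\<close>,
  so they converge to some \<open>L\<close>. By the maximal inequality the path ever moves at least
  \<open>e\<close> away from \<open>X n\<close> after time \<open>n\<close> with probability at most
  \<open>(L - a n) / e\<^sup>2\<close>, which tends to 0. Hence almost every path is Cauchy.\<close>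

theorem bounded_martingale_convergent: "AE x in M. convergent (\<lambda>n. X n x)"
proof -
  note [measurable] = martingale_measurable
  define a where "a n = (\<integral>x. (X n x)\<^sup>2 \<partial>M)" for n
  have "incseq a"
  proof (rule incseq_SucI)
    fix n
    have "0 \<le> (\<integral>x. (X (Suc n) x - X n x)\<^sup>2 \<partial>M)"
      by (intro integral_nonneg_AE) auto
    with integral_increment_sq[of n "Suc n"] show "a n \<le> a (Suc n)"
      by (simp add: a_def)
  qed
  moreover have "a n \<le> B\<^sup>2" for n
  proof -
    have "(X n x)\<^sup>2 \<le> B\<^sup>2" if x: "x \<in> space M" for x
      using bounded[OF x, of n] by (simp add: abs_le_square_iff[symmetric] abs_of_nonneg martingale_bound_nonneg)
    then have "a n \<le> (\<integral>x. B\<^sup>2 \<partial>M)"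
      unfolding a_def using integrable_bounded_mult[of "X n" "X n" B B] bounded
      by (intro integral_mono) (auto simp: power2_eq_square)
    then show ?thesis
      by (simp add: prob_space)
  qed
  ultimately obtain L where L: "a \<longlonglongrightarrow> L" "\<And>n. a n \<le> L"
    using incseq_convergent[of a "B\<^sup>2"] by blast
  have tail: "prob {x \<in> space M. \<exists>k\<ge>n. e \<le> \<bar>X k x - X n x\<bar>} \<le> (L - a n) / e\<^sup>2" if "0 < e" for n e
  proof -
    define E where "E m = {x \<in> space M. \<exists>k\<in>{n..m}. e \<le> \<bar>X k x - X n x\<bar>}" for m
    have [measurable]: "E m \<in> sets M" for m
      unfolding E_def by measurable
    \<comment> \<open>Continuity from below extends the bound from a finite horizon \<open>m\<close>
      to all later times.\<close>
    have "(\<lambda>m. prob (E m)) \<longlonglongrightarrow> prob (\<Union>m. E m)"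
      by (rule finite_Lim_measure_incseq) (auto simp: incseq_def E_def)
    moreover have "prob (E m) \<le> (L - a n) / e\<^sup>2" if "m \<ge> n" for m
    proof -
      have "prob (E m) \<le> (a m - a n) / e\<^sup>2"
        using maximal_inequality[OF that \<open>0 < e\<close>] integral_increment_sq[OF that]
        by (simp add: E_def a_def)
      also have "\<dots> \<le> (L - a n) / e\<^sup>2"
        using L(2)[of m] by (intro divide_right_mono) auto
      finally show ?thesis .
    qed
    ultimately have "prob (\<Union>m. E m) \<le> (L - a n) / e\<^sup>2"
      by (intro Lim_bounded[where M = n]) auto
    moreover have "(\<Union>m. E m) = {x \<in> space M. \<exists>k\<ge>n. e \<le> \<bar>X k x - X n x\<bar>}"
      by (auto simp: E_def) (meson atLeastAtMost_iff order_refl)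
    ultimately show ?thesis
      by simp
  qed
  have "AE x in M. \<exists>n. \<forall>k\<ge>n. \<bar>X k x - X n x\<bar> < e" if "0 < e" for e
  proof -
    define N where "N = {x \<in> space M. \<forall>n. \<exists>k\<ge>n. e \<le> \<bar>X k x - X n x\<bar>}"
    have [measurable]: "N \<in> sets M"
      unfolding N_def by measurable
    have "prob N \<le> (L - a n) / e\<^sup>2" for n
    proof (rule order_trans[OF _ tail[OF that]])
      show "prob N \<le> prob {x \<in> space M. \<exists>k\<ge>n. e \<le> \<bar>X k x - X n x\<bar>}"
        by (intro finite_measure_mono) (auto simp: N_def)
    qed
    moreover have "(\<lambda>n. (L - a n) / e\<^sup>2) \<longlonglongrightarrow> (L - L) / e\<^sup>2"
      using L(1) that by (intro tendsto_intros) auto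
    ultimately have "prob N \<le> (L - L) / e\<^sup>2"
      by (intro LIMSEQ_le_const) auto
    then have "prob N = 0"
      by (simp add: measure_le_0_iff)
    then have "AE x in M. x \<notin> N"
      by (subst (asm) prob_eq_0) auto
    then show ?thesis
      by (rule AE_mp) (rule AE_I2, simp add: N_def not_le, meson not_le)
  qed
  \<comment> \<open>Countably many tolerances suffice for the Cauchy property and share one null
    set.\<close>
  then have "AE x in M. \<forall>i::nat. \<exists>n. \<forall>k\<ge>n. \<bar>X k x - X n x\<bar> < inverse (real (Suc i))"
    by (subst AE_all_countable) auto
  then show ?thesis
  proof eventually_elim
    case (elim x)
    have "Cauchy (\<lambda>n. X n x)"
      unfolding Cauchy_altdef2
    proof (intro allI impI)
      fix e :: real assume "0 < e"
      then obtain i where i: "inverse (real (Suc i)) < e"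
        using reals_Archimedean by blast
      from elim[rule_format, of i] obtain n where "\<forall>k\<ge>n. \<bar>X k x - X n x\<bar> < inverse (real (Suc i))"
        by blast
      then show "\<exists>n. \<forall>k\<ge>n. dist (X k x) (X n x) < e"
        using i by (auto simp: dist_real_def intro: less_trans)
    qed
    then show ?case
      by (simp add: Cauchy_convergent)
  qed
qed

end

end

section \<open>The quenched law\<close>

lemma measurable_plus_nat [measurable (raw)]:
  fixes a b :: "'a \<Rightarrow> nat"
  assumes [measurable]: "a \<in> M \<rightarrow>\<^sub>M count_space UNIV" "b \<in> M \<rightarrow>\<^sub>M count_space UNIV"
  shows "(\<lambda>x. a x + b x) \<in> M \<rightarrow>\<^sub>M count_space UNIV"
  by (rule measurable_compose_countable[of "\<lambda>i x. i + b x", OF _ assms(1)])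
     (rule measurable_compose[OF assms(2)], simp)

text \<open>The map \<open>T\<close> is arbitrary because the lemma serves the quenched law,
  \<open>history n\<close> and coordinate projections of product spaces alike. The random number of
  summands is handled by splitting over the countably many values of \<open>Z n\<close>.\<close>

lemma measurable_Z_compose:
  assumes "\<And>k i. k < n \<Longrightarrow> (\<lambda>x. T x (k, i)) \<in> M \<rightarrow>\<^sub>M count_space UNIV"
  shows "(\<lambda>x. Z n (T x)) \<in> M \<rightarrow>\<^sub>M count_space UNIV"
  using assms
proof (induction n)
  case (Suc n)
  have "(\<lambda>x. \<Sum>i<z. T x (n, i)) \<in> M \<rightarrow>\<^sub>M count_space UNIV" for z
  proof (induction z)
    case (Suc z)
    then show ?case
      using Suc.prems[of n] \<open>\<And>k i. k < Suc n \<Longrightarrow> (\<lambda>x. T x (k, i)) \<in> M \<rightarrow>\<^sub>M count_space UNIV\<close>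
      by (auto intro!: measurable_plus_nat)
  qed simp
  then show ?case
    using Suc by (auto intro!: measurable_compose_countable[where f = "\<lambda>z x. \<Sum>i<z. T x (n, i)"])
qed simp

lemma Z_cong: "(\<And>k i. k < n \<Longrightarrow> \<omega> (k, i) = \<omega>' (k, i)) \<Longrightarrow> Z n \<omega> = Z n \<omega>'"
  by (induction n) auto

lemma Z_pos:
  assumes "\<And>k i. 0 < \<omega> (k, i)"
  shows "0 < Z n \<omega>"
proof (induction n)
  case (Suc n)
  then have "0 < (\<Sum>i<Z n \<omega>. \<omega> (n, i))"
    using assms by (intro sum_pos) auto
  then show ?case
    by simp
qed simp

text \<open>The information in the generations before \<open>n\<close>. Encoding it as a pullback
  under restriction presents each of its events as a preimage of a set of restricted families, which
  fits the independence of disjoint blocks of coordinates.\<close>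

definition history :: "nat \<Rightarrow> offspring measure" where
  "history n = vimage_algebra UNIV (\<lambda>\<omega>. restrict \<omega> ({..<n} \<times> UNIV))
     (Pi\<^sub>M ({..<n} \<times> UNIV) (\<lambda>_. count_space UNIV))"

lemma space_history [simp]: "space (history n) = UNIV"
  by (simp add: history_def)

lemma measurable_history_component:
  assumes "k < n"
  shows "(\<lambda>\<omega>. \<omega> (k, i)) \<in> history n \<rightarrow>\<^sub>M count_space UNIV"
proof -
  have "(\<lambda>\<omega>. restrict \<omega> ({..<n} \<times> UNIV) (k, i)) \<in> history n \<rightarrow>\<^sub>M count_space UNIV"
    unfolding history_def using assms
    by (intro measurable_compose[OF measurable_vimage_algebra1 measurable_component_singleton])
       (auto simp: space_PiM PiE_def extensional_def)
  then show ?thesis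
    using assms by simp
qed

lemma subalgebra_historyI:
  assumes "space M = UNIV" "\<And>k i. k < n \<Longrightarrow> (\<lambda>\<omega>. \<omega> (k, i)) \<in> M \<rightarrow>\<^sub>M count_space UNIV"
  shows "subalgebra M (history n)"
  unfolding subalgebra_def
proof
  have "(\<lambda>\<omega>. restrict \<omega> ({..<n} \<times> UNIV)) \<in> M \<rightarrow>\<^sub>M Pi\<^sub>M ({..<n} \<times> UNIV) (\<lambda>_. count_space UNIV)"
    using assms(2) by (intro measurable_restrict) auto
  then show "sets (history n) \<subseteq> sets M"
    unfolding history_def by (rule sets_image_in_sets[OF assms(1)])
qed (simp add: assms(1))

lemma subalgebra_history_Suc: "subalgebra (history (Suc n)) (history n)"
  by (rule subalgebra_historyI) (auto intro: measurable_history_component)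

lemma measurable_Z_history [measurable]: "Z n \<in> history n \<rightarrow>\<^sub>M count_space UNIV"
  by (rule measurable_Z_compose) (rule measurable_history_component)

section \<open>Coordinates of the quenched law and the branching property\<close>

lemma space_quenched [simp]: "space (quenched \<xi>) = UNIV"
  by (simp add: quenched_def space_PiM case_prod_unfold)

lemma measurable_quenched_component [measurable]:
  "(\<lambda>\<omega>. \<omega> p) \<in> quenched \<xi> \<rightarrow>\<^sub>M count_space UNIV"
  unfolding measurable_cong_sets[OF sets_quenched refl] offspring_space_def
  by (rule measurable_component_singleton) simp

lemma subalgebra_history: "subalgebra (quenched \<xi>) (history n)"
  by (rule subalgebra_historyI) auto

lemma measurable_Z [measurable]: "Z n \<in> quenched \<xi> \<rightarrow>\<^sub>M count_space UNIV"
  by (rule measurable_Z_compose) simp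

lemma distr_quenched_component:
  "distr (quenched \<xi>) (count_space UNIV) (\<lambda>\<omega>. \<omega> (n, i)) = measure_pmf (\<xi> (int n))"
proof -
  have "distr (quenched \<xi>) (measure_pmf (\<xi> (int n))) (\<lambda>\<omega>. \<omega> (n, i)) = measure_pmf (\<xi> (int n))"
    unfolding quenched_def
    using distr_PiM_component[of UNIV "\<lambda>(n, i). measure_pmf (\<xi> (int n))" "(n, i)"]
    by (auto simp: measure_pmf.prob_space_axioms split: prod.split)
  also have "distr (quenched \<xi>) (measure_pmf (\<xi> (int n))) (\<lambda>\<omega>. \<omega> (n, i))
      = distr (quenched \<xi>) (count_space UNIV) (\<lambda>\<omega>. \<omega> (n, i))"
    by (intro distr_cong) auto
  finally show ?thesis .
qed

text \<open>The family of all coordinates is the identity map, so its joint law is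
  \<open>quenched \<xi>\<close> itself, which is the product of the marginals by
  construction.\<close>

lemma indep_vars_quenched:
  "prob_space.indep_vars (quenched \<xi>) (\<lambda>_. count_space UNIV) (\<lambda>p \<omega>. \<omega> p) UNIV"
proof -
  interpret prob_space "quenched \<xi>"
    by (rule prob_space_quenched)
  have "distr (quenched \<xi>) (\<Pi>\<^sub>M p\<in>UNIV. count_space UNIV) (\<lambda>\<omega>. \<lambda>p\<in>UNIV. \<omega> p) = distr (quenched \<xi>) (quenched \<xi>) (\<lambda>\<omega>. \<omega>)"
    by (intro distr_cong) (simp_all add: sets_quenched offspring_space_def restrict_def)
  also have "\<dots> = (\<Pi>\<^sub>M p\<in>UNIV. distr (quenched \<xi>) (count_space UNIV) (\<lambda>\<omega>. \<omega> p))"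
    unfolding distr_id2[OF refl]
    by (subst quenched_def, intro PiM_cong) (auto simp: distr_quenched_component)
  finally show ?thesis
    by (subst indep_vars_iff_distr_eq_PiM') auto
qed

lemma quenched_AE_component:
  assumes "AE j in measure_pmf (\<xi> (int n)). P j"
  shows "AE \<omega> in quenched \<xi>. P (\<omega> (n, i))"
  by (rule AE_distrD[of "\<lambda>\<omega>. \<omega> (n, i)" "quenched \<xi>" "count_space UNIV" P])
     (simp, use assms in \<open>simp only: distr_quenched_component\<close>)

text \<open>Since \<open>y_iter\<close> switches to another formula at 0, comparing it with the
  martingales requires a positive population in every generation.\<close>

lemma quenched_AE_Z_pos:
  assumes "no_extinction \<xi>"
  shows "AE \<omega> in quenched \<xi>. \<forall>n. 0 < Z n \<omega>"
proof -
  have "AE \<omega> in quenched \<xi>. \<forall>p. 0 < \<omega> p"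
  proof (subst AE_all_countable, intro allI)
    fix p :: "nat \<times> nat"
    show "AE \<omega> in quenched \<xi>. 0 < \<omega> p"
      using quenched_AE_component[OF AE_pmf_pos, of \<xi> "fst p" "snd p"] assms
      by (simp add: no_extinction_def)
  qed
  then show ?thesis
    by eventually_elim (auto intro: Z_pos)
qed

text \<open>The number \<open>z\<close> of parents is deterministic here, so independence factorises
  the power; the random \<open>Z n\<close> is inserted afterwards by conditioning on the
  past.\<close>

lemma expectation_power_sum:
  assumes "0 \<le> r" "r \<le> 1"
  shows "(\<integral>\<omega>. r ^ (\<Sum>i<z. \<omega> (n, i)) \<partial>quenched \<xi>) = pgf (\<xi> (int n)) r ^ z"
proof -
  interpret prob_space "quenched \<xi>"
    by (rule prob_space_quenched)
  have ind: "indep_vars (\<lambda>_. borel) (\<lambda>p \<omega>. r ^ \<omega> p) (Pair n ` {..<z})"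
    by (rule indep_vars_compose2[OF indep_vars_subset[OF indep_vars_quenched subset_UNIV]]) simp
  have "(\<integral>\<omega>. r ^ \<omega> (n, i) \<partial>quenched \<xi>) = pgf (\<xi> (int n)) r" for i
    using assms
    by (simp add: pgf_eq_expectation distr_quenched_component[of \<xi> n i, symmetric] integral_distr)
  moreover have "(\<integral>\<omega>. (\<Prod>p\<in>Pair n ` {..<z}. r ^ \<omega> p) \<partial>quenched \<xi>)
      = (\<Prod>p\<in>Pair n ` {..<z}. \<integral>\<omega>. r ^ \<omega> p \<partial>quenched \<xi>)"
    using assms
    by (intro indep_vars_lebesgue_integral ind) (auto intro!: integrable_const_bound[where B = 1] simp: power_le_one)
  ultimately show ?thesis
    by (simp add: power_sum prod.reindex inj_on_def)
qed

text \<open>The branching property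
  \<open>E (r ^ Z (Suc n) | history n) = pgf (\<xi> (int n)) r ^ Z n\<close> in integrated form. The
  generations before \<open>n\<close> and generation \<open>n\<close> are independent blocks, so
  Fubini allows integrating over generation \<open>n\<close> with the past frozen.\<close>

lemma integral_power_Z_Suc:
  assumes "0 \<le> r" "r \<le> 1" "A \<in> sets (history n)"
  shows "(\<integral>\<omega>. indicator A \<omega> * r ^ Z (Suc n) \<omega> \<partial>quenched \<xi>)
    = (\<integral>\<omega>. indicator A \<omega> * pgf (\<xi> (int n)) r ^ Z n \<omega> \<partial>quenched \<xi>)"
proof -
  interpret prob_space "quenched \<xi>"
    by (rule prob_space_quenched)
  let ?C = "\<lambda>_::nat \<times> nat. count_space (UNIV :: nat set)"
  define K where "K = {..<n} \<times> (UNIV :: nat set)"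
  define K' where "K' = {n} \<times> (UNIV :: nat set)"
  define U where "U \<omega> = restrict \<omega> K" for \<omega> :: offspring
  define V where "V \<omega> = restrict \<omega> K'" for \<omega> :: offspring
  \<comment> \<open>An event of the history depends on the past block \<open>U\<close>
    alone.\<close>
  obtain A' where A': "A' \<in> sets (Pi\<^sub>M K ?C)" "A = U -` A'"
    using assms(3) unfolding history_def
    by (subst (asm) sets_vimage_algebra2) (auto simp: space_PiM K_def U_def[abs_def])
  have ind: "indep_var (Pi\<^sub>M K ?C) U (Pi\<^sub>M K' ?C) V"
    using indep_var_restrict[OF indep_vars_quenched, of K K']
    unfolding U_def V_def by (auto simp: K_def K'_def)
  note [measurable] = A'(1) indep_var_rv1[OF ind] indep_var_rv2[OF ind]
  define \<phi> where "\<phi> u v = indicator A' u * r ^ (\<Sum>i<Z n u. v (n, i))" for u v :: offspring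
  have comp_u: "(\<lambda>x. fst x (k, i)) \<in> Pi\<^sub>M K ?C \<Otimes>\<^sub>M Pi\<^sub>M K' ?C \<rightarrow>\<^sub>M count_space UNIV" if "k < n" for k i
    using that by (intro measurable_compose[OF measurable_fst measurable_component_singleton]) (auto simp: K_def)
  have comp_v: "(\<lambda>x. snd x (n, i)) \<in> Pi\<^sub>M K ?C \<Otimes>\<^sub>M Pi\<^sub>M K' ?C \<rightarrow>\<^sub>M count_space UNIV" for i
    by (intro measurable_compose[OF measurable_snd measurable_component_singleton]) (auto simp: K'_def)
  have [measurable]: "(\<lambda>x. \<Sum>i<z. snd x (n, i)) \<in> Pi\<^sub>M K ?C \<Otimes>\<^sub>M Pi\<^sub>M K' ?C \<rightarrow>\<^sub>M count_space UNIV" for z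
    by (induction z) (auto intro!: measurable_plus_nat comp_v)
  have [measurable]: "(\<lambda>x. \<Sum>i<Z n (fst x). snd x (n, i)) \<in> Pi\<^sub>M K ?C \<Otimes>\<^sub>M Pi\<^sub>M K' ?C \<rightarrow>\<^sub>M count_space UNIV"
    by (rule measurable_compose_countable[where f = "\<lambda>z x. \<Sum>i<z. snd x (n, i)"])
       (auto intro: measurable_Z_compose comp_u)
  have \<phi>_meas: "(\<lambda>x. \<phi> (fst x) (snd x)) \<in> borel_measurable (Pi\<^sub>M K ?C \<Otimes>\<^sub>M Pi\<^sub>M K' ?C)"
    unfolding \<phi>_def by measurable
  have \<phi>_le: "\<bar>\<phi> u v\<bar> \<le> 1" for u v
    using assms by (auto simp: \<phi>_def indicator_def power_le_one)
  interpret DU: prob_space "distr (quenched \<xi>) (Pi\<^sub>M K ?C) U"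
    by (rule prob_space_distr) simp
  interpret DV: prob_space "distr (quenched \<xi>) (Pi\<^sub>M K' ?C) V"
    by (rule prob_space_distr) simp
  interpret UV: pair_prob_space "distr (quenched \<xi>) (Pi\<^sub>M K ?C) U" "distr (quenched \<xi>) (Pi\<^sub>M K' ?C) V" ..
  \<comment> \<open>\<open>restrict\<close> puts \<open>undefined\<close> at the remaining
    coordinates, but \<open>Z n\<close> never reads them.\<close>
  have Z_U: "Z n (U \<omega>) = Z n \<omega>" for \<omega>
    by (rule Z_cong) (simp add: U_def K_def)
  \<comment> \<open>Two sample points occur because after Fubini the past and generation
    \<open>n\<close> are drawn independently; the case of equal points recovers
    \<open>Z (Suc n)\<close>.\<close>
  have eq: "\<phi> (U \<omega>) (V \<omega>') = indicator A \<omega> * r ^ (\<Sum>i<Z n \<omega>. \<omega>' (n, i))" for \<omega> \<omega>'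
    by (auto simp: \<phi>_def Z_U A'(2) V_def K'_def indicator_def)
  have "(\<integral>\<omega>. indicator A \<omega> * r ^ Z (Suc n) \<omega> \<partial>quenched \<xi>) = (\<integral>\<omega>. \<phi> (U \<omega>) (V \<omega>) \<partial>quenched \<xi>)"
    by (simp add: eq)
  also have "\<dots> = (\<integral>x. \<phi> (fst x) (snd x) \<partial>distr (quenched \<xi>) (Pi\<^sub>M K ?C \<Otimes>\<^sub>M Pi\<^sub>M K' ?C) (\<lambda>\<omega>. (U \<omega>, V \<omega>)))"
    by (subst integral_distr[OF _ \<phi>_meas]) auto
  also have "\<dots> = (\<integral>x. \<phi> (fst x) (snd x) \<partial>(distr (quenched \<xi>) (Pi\<^sub>M K ?C) U \<Otimes>\<^sub>M distr (quenched \<xi>) (Pi\<^sub>M K' ?C) V))"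
    using ind by (simp add: indep_var_distribution_eq)
  also have "\<dots> = (\<integral>u. (\<integral>v. \<phi> u v \<partial>distr (quenched \<xi>) (Pi\<^sub>M K' ?C) V) \<partial>distr (quenched \<xi>) (Pi\<^sub>M K ?C) U)"
  proof -
    have "integrable (distr (quenched \<xi>) (Pi\<^sub>M K ?C) U \<Otimes>\<^sub>M distr (quenched \<xi>) (Pi\<^sub>M K' ?C) V) (\<lambda>x. \<phi> (fst x) (snd x))"
      using \<phi>_meas \<phi>_le
      by (intro UV.P.integrable_const_bound[where B = 1]) (auto cong: measurable_cong_sets)
    from UV.integral_fst'[OF this] show ?thesis
      by simp
  qed
  also have "\<dots> = (\<integral>\<omega>. (\<integral>\<omega>'. \<phi> (U \<omega>) (V \<omega>') \<partial>quenched \<xi>) \<partial>quenched \<xi>)"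
  proof -
    have V: "(\<integral>v. \<phi> u v \<partial>distr (quenched \<xi>) (Pi\<^sub>M K' ?C) V) = (\<integral>\<omega>'. \<phi> u (V \<omega>') \<partial>quenched \<xi>)"
      if "u \<in> space (Pi\<^sub>M K ?C)" for u
      using measurable_compose[OF measurable_Pair1'[OF that] \<phi>_meas]
      by (intro integral_distr) auto
    have "(\<lambda>u. \<integral>v. \<phi> u v \<partial>distr (quenched \<xi>) (Pi\<^sub>M K' ?C) V) \<in> borel_measurable (Pi\<^sub>M K ?C)"
      using \<phi>_meas by (intro DV.borel_measurable_lebesgue_integral) (simp add: case_prod_unfold cong: measurable_cong_sets)
    then show ?thesis
      by (subst integral_distr) (auto intro!: Bochner_Integration.integral_cong V simp: measurable_space[OF indep_var_rv1[OF ind]])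
  qed
  also have "\<dots> = (\<integral>\<omega>. indicator A \<omega> * pgf (\<xi> (int n)) r ^ Z n \<omega> \<partial>quenched \<xi>)"
    by (simp add: eq expectation_power_sum[OF assms(1,2)])
  finally show ?thesis .
qed

section \<open>The limit of the bounded martingales and of the normalized process\<close>

definition exp_mart :: "environment \<Rightarrow> real \<Rightarrow> nat \<Rightarrow> offspring \<Rightarrow> real" where
  "exp_mart \<xi> s n \<omega> = exp (- (real (Z n \<omega>) * h_iter n \<xi> s))"

text \<open>Almost surely this is exp (-W), with value 0 where W is infinite.\<close>

definition exp_lim :: "environment \<Rightarrow> real \<Rightarrow> offspring \<Rightarrow> real" where
  "exp_lim \<xi> s \<omega> = lim (\<lambda>n. exp_mart \<xi> s n \<omega>)"

lemma exp_mart_eq_power: "exp_mart \<xi> s n \<omega> = exp (- h_iter n \<xi> s) ^ Z n \<omega>"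
  by (simp add: exp_mart_def exp_of_nat_mult[symmetric])

definition y_lim :: "environment \<Rightarrow> offspring \<Rightarrow> real" where
  "y_lim \<xi> \<omega> = lim (\<lambda>n. y_iter n \<xi> (real (Z n \<omega>)))"

lemma measurable_y_lim [measurable]: "y_lim \<xi> \<in> borel_measurable (quenched \<xi>)"
  unfolding y_lim_def[abs_def] by measurable

lemma measurable_exp_mart [measurable]: "exp_mart \<xi> s n \<in> borel_measurable (quenched \<xi>)"
  unfolding exp_mart_def[abs_def] by measurable

lemma measurable_exp_lim [measurable]: "exp_lim \<xi> s \<in> borel_measurable (quenched \<xi>)"
  unfolding exp_lim_def[abs_def] by measurable

text \<open>Apply -log to the convergence. The limit 0 is treated apart because there the logarithm
  diverges and \<open>W\<close> is infinite.\<close>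

lemma W_eq_exp_lim:
  assumes "(\<lambda>n. exp_mart \<xi> s n \<omega>) \<longlonglongrightarrow> l"
  shows "W \<xi> s \<omega> = (if l = 0 then \<infinity> else ennreal (- ln l))"
proof -
  have "0 \<le> l"
    using assms by (rule LIMSEQ_le_const) (auto simp: exp_mart_def)
  have ln: "real (Z n \<omega>) * h_iter n \<xi> s = - ln (exp_mart \<xi> s n \<omega>)" for n
    by (simp add: exp_mart_def)
  show ?thesis
  proof (cases "l = 0")
    case True
    have "filterlim (\<lambda>n. exp_mart \<xi> s n \<omega>) (at_right 0) sequentially"
      using assms True by (intro tendsto_imp_filterlim_at_right) (auto simp: exp_mart_def)
    then have "LIM n sequentially. ln (exp_mart \<xi> s n \<omega>) :> at_bot"
      by (rule filterlim_compose[OF ln_at_0])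
    then have "LIM n sequentially. real (Z n \<omega>) * h_iter n \<xi> s :> at_top"
      by (simp add: ln filterlim_uminus_at_top)
    then have "(\<lambda>n. ennreal (real (Z n \<omega>) * h_iter n \<xi> s)) \<longlonglongrightarrow> \<infinity>"
      by (simp add: ennreal_tendsto_top_eq_at_top)
    then show ?thesis
      using True by (simp add: W_def limI)
  next
    case False
    then have "(\<lambda>n. - ln (exp_mart \<xi> s n \<omega>)) \<longlonglongrightarrow> - ln l"
      using assms by (intro tendsto_intros) auto
    then have "(\<lambda>n. ennreal (real (Z n \<omega>) * h_iter n \<xi> s)) \<longlonglongrightarrow> ennreal (- ln l)"
      unfolding ln by (rule tendsto_ennrealI)
    then show ?thesis
      using False by (simp add: W_def limI)
  qed
qed

context
  fixes \<xi> :: environment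
  assumes no_ext: "no_extinction \<xi>"
begin

interpretation Q: prob_space "quenched \<xi>"
  by (rule prob_space_quenched)

lemma exp_mart_bounds: "0 \<le> s \<Longrightarrow> 0 < exp_mart \<xi> s n \<omega> \<and> exp_mart \<xi> s n \<omega> \<le> 1"
  using h_iter_nonneg[OF no_ext] by (simp add: exp_mart_def)

text \<open>The normalisation is made for this: with
  \<open>r = exp (- h_iter (Suc n) \<xi> s)\<close> in the branching property, the generating
  function takes the base \<open>r\<close> back to \<open>exp (- h_iter n \<xi> s)\<close>.\<close>

lemma exp_mart_step:
  assumes "0 \<le> s" "A \<in> sets (history n)"
  shows "(\<integral>\<omega>. indicator A \<omega> * exp_mart \<xi> s (Suc n) \<omega> \<partial>quenched \<xi>)
    = (\<integral>\<omega>. indicator A \<omega> * exp_mart \<xi> s n \<omega> \<partial>quenched \<xi>)"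
proof -
  have "pgf (\<xi> (int n)) (exp (- h_iter (Suc n) \<xi> s)) = exp (- h_iter n \<xi> s)"
    using no_ext h_iter_nonneg[OF no_ext assms(1)] by (auto simp: no_extinction_def pgf_exp_h_step)
  then show ?thesis
    using integral_power_Z_Suc[of "exp (- h_iter (Suc n) \<xi> s)", OF _ _ assms(2)]
      h_iter_nonneg[OF no_ext assms(1), of "Suc n"]
    unfolding exp_mart_eq_power by simp
qed

lemma integrable_exp_mart: "0 \<le> s \<Longrightarrow> integrable (quenched \<xi>) (exp_mart \<xi> s n)"
  using exp_mart_bounds
  by (intro Q.integrable_const_bound[where B = 1]) (auto intro!: AE_I2 simp: abs_of_pos)

lemma expectation_exp_mart: "0 \<le> s \<Longrightarrow> Q.expectation (exp_mart \<xi> s n) = exp (- s)"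
proof (induction n)
  case 0
  then show ?case
    using Q.prob_space by (simp add: exp_mart_def[abs_def])
next
  case (Suc n)
  then show ?case
    using exp_mart_step[of s UNIV n] by (simp add: sets.top[of "history n", simplified])
qed

lemma AE_exp_mart_tendsto:
  assumes "0 \<le> s"
  shows "AE \<omega> in quenched \<xi>. (\<lambda>n. exp_mart \<xi> s n \<omega>) \<longlonglongrightarrow> exp_lim \<xi> s \<omega>"
proof -
  have adapted: "exp_mart \<xi> s n \<in> borel_measurable (history n)" for n
    unfolding exp_mart_def[abs_def] by measurable
  have "AE \<omega> in quenched \<xi>. convergent (\<lambda>n. exp_mart \<xi> s n \<omega>)"
  proof (rule Q.bounded_martingale_convergent[where F = history and B = 1, OF subalgebra_history subalgebra_history_Suc adapted])
    show "\<bar>exp_mart \<xi> s n \<omega>\<bar> \<le> 1" for n \<omega>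
      using exp_mart_bounds[OF assms, of n \<omega>] by simp
    fix n
    interpret finite_measure_subalgebra "quenched \<xi>" "history n"
      by unfold_locales (rule subalgebra_history)
    show "AE \<omega> in quenched \<xi>. real_cond_exp (quenched \<xi>) (history n) (exp_mart \<xi> s (Suc n)) \<omega> = exp_mart \<xi> s n \<omega>"
      by (intro real_cond_exp_charact integrable_exp_mart assms adapted)
         (simp add: set_lebesgue_integral_def exp_mart_step[OF assms])
  qed
  then show ?thesis
    by eventually_elim (simp add: exp_lim_def convergent_LIMSEQ_iff)
qed

text \<open>Dominated convergence with the bound 1 carries the common mean of the martingale to the
  limit. This mean is the origin of the uniform law.\<close>

lemma expectation_exp_lim:
  assumes "0 \<le> s"
  shows "integrable (quenched \<xi>) (exp_lim \<xi> s)" "Q.expectation (exp_lim \<xi> s) = exp (- s)"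
proof -
  have bound: "AE \<omega> in quenched \<xi>. norm (exp_mart \<xi> s n \<omega>) \<le> 1" for n
    using exp_mart_bounds[OF assms] by (auto simp: abs_of_pos)
  show "integrable (quenched \<xi>) (exp_lim \<xi> s)"
    by (rule integrable_dominated_convergence[OF _ _ _ AE_exp_mart_tendsto[OF assms] bound]) auto
  have "(\<lambda>n. Q.expectation (exp_mart \<xi> s n)) \<longlonglongrightarrow> Q.expectation (exp_lim \<xi> s)"
    by (rule integral_dominated_convergence[OF _ _ _ AE_exp_mart_tendsto[OF assms] bound]) auto
  then show "Q.expectation (exp_lim \<xi> s) = exp (- s)"
    using assms by (simp add: expectation_exp_mart LIMSEQ_const_iff)
qed

lemma AE_exp_lim_bounds:
  assumes "0 \<le> s"
  shows "AE \<omega> in quenched \<xi>. 0 \<le> exp_lim \<xi> s \<omega> \<and> exp_lim \<xi> s \<omega> \<le> 1"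
  using AE_exp_mart_tendsto[OF assms]
proof eventually_elim
  case (elim \<omega>)
  show ?case
    using LIMSEQ_le_const[OF elim, of 0] LIMSEQ_le_const2[OF elim, of 1] exp_mart_bounds[OF assms]
    by (auto intro: less_imp_le)
qed

lemma AE_exp_lim_antimono:
  assumes "0 \<le> s" "s \<le> t"
  shows "AE \<omega> in quenched \<xi>. exp_lim \<xi> t \<omega> \<le> exp_lim \<xi> s \<omega>"
proof -
  have "0 \<le> t"
    using assms by simp
  from AE_exp_mart_tendsto[OF assms(1)] AE_exp_mart_tendsto[OF this] show ?thesis
  proof eventually_elim
    case (elim \<omega>)
    show ?case
      using h_iter_mono[OF no_ext assms]
      by (intro LIMSEQ_le[OF elim(2,1)]) (auto simp: exp_mart_def mult_left_mono)
  qed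
qed

lemma AE_exp_lim_le_powr:
  assumes "0 < s" "s \<le> t"
  shows "AE \<omega> in quenched \<xi>. exp_lim \<xi> t \<omega> \<le> exp_lim \<xi> s \<omega> powr (t / s)"
proof -
  have "0 \<le> t" "0 \<le> s"
    using assms by simp_all
  from AE_exp_mart_tendsto[OF this(1)] AE_exp_mart_tendsto[OF this(2)] AE_exp_lim_bounds[OF this(2)] show ?thesis
  proof eventually_elim
    case (elim \<omega>)
    have le: "exp_mart \<xi> t n \<omega> \<le> exp_mart \<xi> s n \<omega> powr (t / s)" for n
      using mult_left_mono[OF mult_h_iter_le[OF no_ext \<open>0 \<le> s\<close>, of "t / s" n], of "real (Z n \<omega>)"] assms
      by (simp add: exp_mart_def powr_def mult_ac)
    \<comment> \<open>The limit of the base may be 0, so continuity of \<open>powr\<close> is used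
      in the form for nonnegative bases and a positive exponent.\<close>
    have "(\<lambda>n. exp_mart \<xi> s n \<omega> powr (t / s)) \<longlonglongrightarrow> exp_lim \<xi> s \<omega> powr (t / s)"
      using assms exp_mart_bounds[OF \<open>0 \<le> s\<close>]
      by (intro tendsto_powr2 elim(2) tendsto_const) (auto intro!: always_eventually less_imp_le)
    then show ?case
      by (rule LIMSEQ_le[OF elim(1)]) (use le in auto)
  qed
qed

text \<open>Markov's inequality for the almost surely nonnegative difference
  \<open>exp_lim \<xi> s - exp_lim \<xi> t\<close>. Letting \<open>t\<close> approach
  \<open>s\<close> shows that an event forcing a fixed jump at \<open>s\<close> is null.\<close>

lemma prob_exp_lim_gap:
  assumes "0 \<le> s" "s \<le> t" "0 < c" "AE \<omega> in quenched \<xi>. P \<omega> \<longrightarrow> c \<le> exp_lim \<xi> s \<omega> - exp_lim \<xi> t \<omega>"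
    and [measurable]: "Measurable.pred (quenched \<xi>) P"
  shows "Q.prob {\<omega>. P \<omega>} \<le> (exp (- s) - exp (- t)) / c"
proof -
  have t: "0 \<le> t"
    using assms by simp
  have "Q.prob {\<omega>. P \<omega>} \<le> Q.prob {\<omega> \<in> space (quenched \<xi>). c \<le> exp_lim \<xi> s \<omega> - exp_lim \<xi> t \<omega>}"
  proof (rule Q.finite_measure_mono_AE)
    show "{\<omega> \<in> space (quenched \<xi>). c \<le> exp_lim \<xi> s \<omega> - exp_lim \<xi> t \<omega>} \<in> Q.events"
      by measurable
  qed (use assms(4) in simp)
  also have "\<dots> \<le> (\<integral>\<omega>. exp_lim \<xi> s \<omega> - exp_lim \<xi> t \<omega> \<partial>quenched \<xi>) / c"
  proof (rule integral_Markov_inequality_measure[where A = UNIV])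
    show "AE \<omega> in quenched \<xi>. 0 \<le> exp_lim \<xi> s \<omega> - exp_lim \<xi> t \<omega>"
      using AE_exp_lim_antimono[OF assms(1,2)] by simp
    show "UNIV \<in> sets (quenched \<xi>)"
      using sets.top[of "quenched \<xi>"] by simp
  qed (use expectation_exp_lim assms t in auto)
  also have "\<dots> = (exp (- s) - exp (- t)) / c"
    using expectation_exp_lim[OF assms(1)] expectation_exp_lim[OF t] by simp
  finally show ?thesis .
qed

section \<open>Convergence of y_n(Z_n)\<close>

lemma y_iter_Z_le_iff:
  "0 \<le> s \<Longrightarrow> 0 < Z n \<omega> \<Longrightarrow> y_iter n \<xi> (real (Z n \<omega>)) \<le> exp (- s) \<longleftrightarrow> exp (- 1) \<le> exp_mart \<xi> s n \<omega>"
  using y_iter_le_iff[OF no_ext] by (simp add: exp_mart_def)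

text \<open>An oscillating path is infinitely often below some level \<open>exp (- t)\<close> and
  infinitely often above a larger level \<open>exp (- s)\<close>. The former forces
  \<open>exp (- 1) \<le> exp_lim \<xi> t \<omega>\<close>, the latter
  \<open>exp_lim \<xi> s \<omega> \<le> exp (- 1)\<close>. As \<open>s < t\<close>,
  \<open>AE_exp_lim_le_powr\<close> yields \<open>exp (- 1) \<le> exp (- 1) powr (t / s)\<close>,
  which is false.\<close>

lemma AE_y_iter_convergent:
  "AE \<omega> in quenched \<xi>. convergent (\<lambda>n. y_iter n \<xi> (real (Z n \<omega>)))"
proof -
  \<comment> \<open>Countably many rational pairs share one null set, so the pair may afterwards be
    chosen depending on the sample point.\<close>
  have "AE \<omega> in quenched \<xi>. \<forall>p\<in>{p \<in> \<rat> \<times> \<rat>. 0 < fst p \<and> fst p < snd p}.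
      (\<lambda>n. exp_mart \<xi> (fst p) n \<omega>) \<longlonglongrightarrow> exp_lim \<xi> (fst p) \<omega> \<and>
      (\<lambda>n. exp_mart \<xi> (snd p) n \<omega>) \<longlonglongrightarrow> exp_lim \<xi> (snd p) \<omega> \<and>
      0 \<le> exp_lim \<xi> (fst p) \<omega> \<and> exp_lim \<xi> (snd p) \<omega> \<le> exp_lim \<xi> (fst p) \<omega> powr (snd p / fst p)"
  proof (rule AE_ball_countable')
    show "countable {p \<in> \<rat> \<times> \<rat>. 0 < fst p \<and> fst p < (snd p :: real)}"
      by (rule countable_subset[of _ "\<rat> \<times> \<rat>"]) (auto intro: countable_rat)
    fix p :: "real \<times> real" assume p: "p \<in> {p \<in> \<rat> \<times> \<rat>. 0 < fst p \<and> fst p < snd p}"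
    have "0 \<le> fst p" "0 \<le> snd p" "0 < fst p" "fst p \<le> snd p"
      using p by auto
    from AE_exp_mart_tendsto[OF this(1)] AE_exp_mart_tendsto[OF this(2)] AE_exp_lim_bounds[OF this(1)]
      AE_exp_lim_le_powr[OF this(3,4)]
    show "AE \<omega> in quenched \<xi>. (\<lambda>n. exp_mart \<xi> (fst p) n \<omega>) \<longlonglongrightarrow> exp_lim \<xi> (fst p) \<omega> \<and>
      (\<lambda>n. exp_mart \<xi> (snd p) n \<omega>) \<longlonglongrightarrow> exp_lim \<xi> (snd p) \<omega> \<and>
      0 \<le> exp_lim \<xi> (fst p) \<omega> \<and> exp_lim \<xi> (snd p) \<omega> \<le> exp_lim \<xi> (fst p) \<omega> powr (snd p / fst p)"
      by eventually_elim auto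
  qed
  with quenched_AE_Z_pos[OF no_ext] show ?thesis
  proof eventually_elim
    case (elim \<omega>)
    define y where "y n = y_iter n \<xi> (real (Z n \<omega>))" for n
    have y: "0 < y n" "y n < 1" for n
      using y_iter_range[OF no_ext, of "real (Z n \<omega>)" n] elim(1) by (auto simp: y_def)
    have "limsup (\<lambda>n. ereal (y n)) \<le> liminf (\<lambda>n. ereal (y n))"
    proof (rule ccontr)
      assume "\<not> limsup (\<lambda>n. ereal (y n)) \<le> liminf (\<lambda>n. ereal (y n))"
      then obtain a where a: "liminf (\<lambda>n. ereal (y n)) < ereal a" "ereal a < limsup (\<lambda>n. ereal (y n))"
        by (meson not_le ereal_dense2)
      obtain b where b: "ereal a < ereal b" "ereal b < limsup (\<lambda>n. ereal (y n))"
        using ereal_dense2[OF a(2)] by blast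
      have freq_a: "\<exists>\<^sub>F n in sequentially. y n < a"
      proof (rule ccontr)
        assume "\<not> ?thesis"
        then have "\<forall>\<^sub>F n in sequentially. ereal a \<le> ereal (y n)"
          by (simp add: frequently_def not_less)
        then show False
          using Liminf_bounded[of "ereal a" "\<lambda>n. ereal (y n)" sequentially] a(1) by simp
      qed
      have freq_b: "\<exists>\<^sub>F n in sequentially. b < y n"
      proof (rule ccontr)
        assume "\<not> ?thesis"
        then have "\<forall>\<^sub>F n in sequentially. ereal (y n) \<le> ereal b"
          by (simp add: frequently_def not_less)
        then show False
          using Limsup_bounded[of "\<lambda>n. ereal (y n)" "ereal b" sequentially] b(2) by simp
      qed
      have "0 < a" "b < 1"
        using freq_a freq_b y by (auto dest!: frequently_ex intro: less_trans)
      with b(1) have ab: "0 < a" "a < b" "b < 1"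
        by auto
      \<comment> \<open>The logarithm reverses the order: the rationals \<open>s < t\<close> are
        chosen with \<open>a < exp (- t) < exp (- s) < b\<close>.\<close>
      then have "- ln b < - ln a" "0 < - ln b"
        by auto
      then obtain s where s: "s \<in> \<rat>" "- ln b < s" "s < - ln a"
        using Rats_dense_in_real by blast
      then obtain t where t: "t \<in> \<rat>" "s < t" "t < - ln a"
        using Rats_dense_in_real by blast
      have "0 < s"
        using s(2) \<open>0 < - ln b\<close> by simp
      have "a < exp (- t)"
        using t(3) ab(1) by (metis exp_less_mono exp_ln minus_less_iff less_minus_iff)
      have "exp (- s) < b"
        using s(2) ab by (metis exp_less_mono exp_ln minus_less_iff less_trans)
      have "(s, t) \<in> {p \<in> \<rat> \<times> \<rat>. 0 < fst p \<and> fst p < snd p}"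
        using s t \<open>0 < s\<close> by simp
      from elim(2)[rule_format, OF this]
      have lim: "(\<lambda>n. exp_mart \<xi> s n \<omega>) \<longlonglongrightarrow> exp_lim \<xi> s \<omega>" "(\<lambda>n. exp_mart \<xi> t n \<omega>) \<longlonglongrightarrow> exp_lim \<xi> t \<omega>"
        and nonneg: "0 \<le> exp_lim \<xi> s \<omega>"
        and le_powr: "exp_lim \<xi> t \<omega> \<le> exp_lim \<xi> s \<omega> powr (t / s)"
        by auto
      have "exp (- 1) \<le> exp_lim \<xi> t \<omega>"
      proof (rule ccontr)
        assume "\<not> exp (- 1) \<le> exp_lim \<xi> t \<omega>"
        then have "\<forall>\<^sub>F n in sequentially. exp_mart \<xi> t n \<omega> < exp (- 1)"
          by (intro order_tendstoD(2)[OF lim(2)]) simp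
        with freq_a have "\<exists>\<^sub>F n in sequentially. y n < a \<and> exp_mart \<xi> t n \<omega> < exp (- 1)"
          by (rule frequently_eventually_frequently)
        then obtain n where "y n < a" "exp_mart \<xi> t n \<omega> < exp (- 1)"
          by (auto dest: frequently_ex)
        then show False
          using y_iter_Z_le_iff[of t n \<omega>] elim(1) \<open>0 < s\<close> t(2) \<open>a < exp (- t)\<close> by (auto simp: y_def)
      qed
      moreover have "exp_lim \<xi> s \<omega> \<le> exp (- 1)"
      proof (rule ccontr)
        assume "\<not> exp_lim \<xi> s \<omega> \<le> exp (- 1)"
        then have "\<forall>\<^sub>F n in sequentially. exp (- 1) < exp_mart \<xi> s n \<omega>"
          by (intro order_tendstoD(1)[OF lim(1)]) simp
        with freq_b have "\<exists>\<^sub>F n in sequentially. b < y n \<and> exp (- 1) < exp_mart \<xi> s n \<omega>"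
          by (rule frequently_eventually_frequently)
        then obtain n where "b < y n" "exp (- 1) < exp_mart \<xi> s n \<omega>"
          by (auto dest: frequently_ex)
        then show False
          using y_iter_Z_le_iff[of s n \<omega>] elim(1) \<open>0 < s\<close> \<open>exp (- s) < b\<close> by (auto simp: y_def)
      qed
      ultimately have "exp (- 1) \<le> exp (- 1) powr (t / s)"
        using le_powr nonneg \<open>0 < s\<close> t(2) by (meson divide_nonneg_pos less_imp_le order_trans powr_mono2)
      then show False
        using \<open>0 < s\<close> t(2) by (simp add: powr_def)
    qed
    then have eq: "limsup (\<lambda>n. ereal (y n)) = liminf (\<lambda>n. ereal (y n))"
      by (intro antisym Liminf_le_Limsup) auto
    have "0 \<le> liminf (\<lambda>n. ereal (y n))" "limsup (\<lambda>n. ereal (y n)) \<le> 1"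
      using y
      by (intro Liminf_bounded Limsup_bounded always_eventually; simp add: order_less_imp_le)+
    then obtain r where "liminf (\<lambda>n. ereal (y n)) = ereal r"
      using eq by (cases "liminf (\<lambda>n. ereal (y n))") auto
    then have "(\<lambda>n. ereal (y n)) \<longlonglongrightarrow> ereal r"
      using eq by (intro Liminf_eq_Limsup) auto
    then show ?case
      by (auto simp: y_def convergent_def)
  qed
qed

section \<open>Law of the limit\<close>

lemma AE_y_iter_tendsto:
  "AE \<omega> in quenched \<xi>. (\<lambda>n. y_iter n \<xi> (real (Z n \<omega>))) \<longlonglongrightarrow> y_lim \<xi> \<omega>"
  using AE_y_iter_convergent by eventually_elim (simp add: y_lim_def convergent_LIMSEQ_iff)

text \<open>A strict inequality between the limit and the level holds eventually along the path, and
  the resulting bound on the martingale passes to its limit. Equality with the level decides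
  nothing, which is why atoms are excluded separately.\<close>

lemma AE_y_lim_exp_lim:
  assumes "0 \<le> s"
  shows "AE \<omega> in quenched \<xi>. (exp (- s) < y_lim \<xi> \<omega> \<longrightarrow> exp_lim \<xi> s \<omega> \<le> exp (- 1)) \<and>
    (y_lim \<xi> \<omega> < exp (- s) \<longrightarrow> exp (- 1) \<le> exp_lim \<xi> s \<omega>)"
  using AE_y_iter_tendsto AE_exp_mart_tendsto[OF assms] quenched_AE_Z_pos[OF no_ext]
proof eventually_elim
  case (elim \<omega>)
  show ?case
  proof (intro conjI impI)
    assume "exp (- s) < y_lim \<xi> \<omega>"
    from order_tendstoD(1)[OF elim(1) this]
    have "\<forall>\<^sub>F n in sequentially. exp_mart \<xi> s n \<omega> \<le> exp (- 1)"
    proof eventually_elim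
      case (elim n)
      with y_iter_Z_le_iff[OF assms, of n \<omega>] \<open>\<forall>n. 0 < Z n \<omega>\<close> show ?case
        by (metis linorder_not_le order_less_imp_le)
    qed
    then show "exp_lim \<xi> s \<omega> \<le> exp (- 1)"
      by (rule tendsto_upperbound[OF elim(2)]) simp
  next
    assume "y_lim \<xi> \<omega> < exp (- s)"
    from order_tendstoD(2)[OF elim(1) this]
    have "\<forall>\<^sub>F n in sequentially. exp (- 1) \<le> exp_mart \<xi> s n \<omega>"
    proof eventually_elim
      case (elim n)
      with y_iter_Z_le_iff[OF assms, of n \<omega>] \<open>\<forall>n. 0 < Z n \<omega>\<close> show ?case
        by (metis order_less_imp_le)
    qed
    then show "exp (- 1) \<le> exp_lim \<xi> s \<omega>"
      by (rule tendsto_lowerbound[OF elim(2)]) simp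
  qed
qed

text \<open>If \<open>W s\<close> is \<open>0\<close> and the limit equals \<open>exp (- s)\<close>, then \<open>W t \<ge> 1\<close> for all \<open>t > s\<close>; such a jump
  of \<open>exp (- W)\<close> at \<open>s\<close> is impossible because its expectation \<open>exp (- s)\<close> is continuous.\<close>

lemma prob_y_lim_exp_lim_one:
  assumes "0 \<le> s"
  shows "Q.prob {\<omega>. y_lim \<xi> \<omega> = exp (- s) \<and> exp_lim \<xi> s \<omega> = 1} = 0" (is "?p = 0")
proof -
  \<comment> \<open>The size of the jump from \<open>exp_lim \<xi> s \<omega> = 1\<close> down to a
    value at most \<open>exp (- 1)\<close> at any later point.\<close>
  define c :: real where "c = 1 - exp (- 1)"
  have c: "0 < c"
    by (simp add: c_def)
  have "?p \<le> (exp (- s) - exp (- (s + inverse (real (Suc n))))) / c" for n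
  proof (rule prob_exp_lim_gap[OF assms _ c])
    let ?t = "s + inverse (real (Suc n))"
    have t: "0 \<le> ?t" "s < ?t"
      using assms by simp_all
    show "AE \<omega> in quenched \<xi>. y_lim \<xi> \<omega> = exp (- s) \<and> exp_lim \<xi> s \<omega> = 1 \<longrightarrow>
        c \<le> exp_lim \<xi> s \<omega> - exp_lim \<xi> ?t \<omega>"
      using AE_y_lim_exp_lim[OF t(1)] by eventually_elim (use t(2) in \<open>auto simp: c_def\<close>)
  qed auto
  moreover have "(\<lambda>n. (exp (- s) - exp (- (s + inverse (real (Suc n))))) / c)
      \<longlonglongrightarrow> (exp (- s) - exp (- (s + 0))) / c"
    by (intro tendsto_intros LIMSEQ_inverse_real_of_nat) (use c in auto)
  ultimately have "?p \<le> (exp (- s) - exp (- (s + 0))) / c"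
    by (intro LIMSEQ_le_const) auto
  then show ?thesis
    by (simp add: measure_le_0_iff)
qed

text \<open>The mirror image, with \<open>s\<close> approached from the left: the limit is then
  strictly below \<open>exp (- t n)\<close>, which forces
  \<open>exp_lim \<xi> (t n) \<omega>\<close> to be at least \<open>exp (- 1)\<close> while the
  value at \<open>s\<close> is 0.\<close>

lemma prob_y_lim_exp_lim_zero:
  assumes "0 < s"
  shows "Q.prob {\<omega>. y_lim \<xi> \<omega> = exp (- s) \<and> exp_lim \<xi> s \<omega> = 0} = 0" (is "?p = 0")
proof -
  \<comment> \<open>Scaling instead of subtracting \<open>inverse (real (Suc n))\<close> keeps every
    \<open>t n\<close> nonnegative.\<close>
  define t where "t n = s - s * inverse (real (Suc n))" for n
  have t: "0 \<le> t n" "t n < s" for n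
    using assms by (simp_all add: t_def field_simps)
  have "?p \<le> (exp (- t n) - exp (- s)) / exp (- 1)" for n
  proof (rule prob_exp_lim_gap[OF t(1)])
    show "AE \<omega> in quenched \<xi>. y_lim \<xi> \<omega> = exp (- s) \<and> exp_lim \<xi> s \<omega> = 0 \<longrightarrow>
        exp (- 1) \<le> exp_lim \<xi> (t n) \<omega> - exp_lim \<xi> s \<omega>"
      using AE_y_lim_exp_lim[OF t(1)] by eventually_elim (use t(2) in auto)
    show "t n \<le> s"
      using t(2) by (rule less_imp_le)
  qed auto
  moreover have "(\<lambda>n. (exp (- t n) - exp (- s)) / exp (- 1)) \<longlonglongrightarrow> (exp (- (s - s * 0)) - exp (- s)) / exp (- 1)"
    unfolding t_def by (intro tendsto_intros LIMSEQ_inverse_real_of_nat) auto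
  ultimately have "?p \<le> (exp (- (s - s * 0)) - exp (- s)) / exp (- 1)"
    by (rule LIMSEQ_le_const[rotated, OF exI, OF allI, OF impI])
  then show ?thesis
    by (simp add: measure_le_0_iff)
qed

lemma exp_mart_0: "exp_mart \<xi> 0 n \<omega> = 1"
  by (simp add: exp_mart_def h_iter_0[OF no_ext])

text \<open>The value 0 lies below every level \<open>exp (- real n)\<close>, so there
  \<open>exp_lim \<xi> (real n)\<close> is at least \<open>exp (- 1)\<close>; Markov's inequality
  with its mean \<open>exp (- real n)\<close> makes this arbitrarily unlikely.\<close>

lemma prob_y_lim_0: "Q.prob {\<omega>. y_lim \<xi> \<omega> = 0} = 0" (is "?p = 0")
proof -
  have "?p \<le> exp (- real n) / exp (- 1)" for n
  proof -
    have "?p \<le> Q.prob {\<omega> \<in> space (quenched \<xi>). exp (- 1) \<le> exp_lim \<xi> (real n) \<omega>}"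
    proof (rule Q.finite_measure_mono_AE)
      show "AE \<omega> in quenched \<xi>. \<omega> \<in> {\<omega>. y_lim \<xi> \<omega> = 0} \<longrightarrow>
          \<omega> \<in> {\<omega> \<in> space (quenched \<xi>). exp (- 1) \<le> exp_lim \<xi> (real n) \<omega>}"
        using AE_y_lim_exp_lim[of "real n"] by auto
      show "{\<omega> \<in> space (quenched \<xi>). exp (- 1) \<le> exp_lim \<xi> (real n) \<omega>} \<in> Q.events"
        by measurable
    qed
    also have "\<dots> \<le> Q.expectation (exp_lim \<xi> (real n)) / exp (- 1)"
    proof (rule integral_Markov_inequality_measure[where A = UNIV])
      show "AE \<omega> in quenched \<xi>. 0 \<le> exp_lim \<xi> (real n) \<omega>"
        using AE_exp_lim_bounds[of "real n"] by auto
      show "UNIV \<in> sets (quenched \<xi>)"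
        using sets.top[of "quenched \<xi>"] by simp
    qed (use expectation_exp_lim in auto)
    finally show ?thesis
      by (simp add: expectation_exp_lim)
  qed
  moreover have "(\<lambda>n. exp (- real n)) \<longlonglongrightarrow> 0"
    by (rule filterlim_compose[OF exp_at_bot])
       (simp add: filterlim_uminus_at_bot filterlim_real_sequentially)
  then have "(\<lambda>n. exp (- real n) / exp (- 1)) \<longlonglongrightarrow> 0 / exp (- 1)"
    by (intro tendsto_intros) auto
  ultimately have "?p \<le> 0 / exp (- 1)"
    by (rule LIMSEQ_le_const[rotated, OF exI, OF allI, OF impI])
  then show ?thesis
    by (simp add: measure_le_0_iff)
qed

lemma AE_y_lim_range: "AE \<omega> in quenched \<xi>. y_lim \<xi> \<omega> \<in> {0<..<1}"
proof -
  have "{\<omega>. y_lim \<xi> \<omega> = 0} \<in> Q.events" "{\<omega>. y_lim \<xi> \<omega> = 1} \<in> Q.events"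
    using measurable_sets[OF measurable_y_lim, of "{0}" \<xi>] measurable_sets[OF measurable_y_lim, of "{1}" \<xi>]
    by (simp_all add: vimage_def)
  \<comment> \<open>The value 1 is the level \<open>exp (- s)\<close> at \<open>s = 0\<close>, where
    the martingale and hence its limit are identically 1.\<close>
  moreover have "Q.prob {\<omega>. y_lim \<xi> \<omega> = 1} = 0"
    using prob_y_lim_exp_lim_one[of 0] by (simp add: exp_lim_def exp_mart_0)
  ultimately have "AE \<omega> in quenched \<xi>. y_lim \<xi> \<omega> \<noteq> 0" "AE \<omega> in quenched \<xi>. y_lim \<xi> \<omega> \<noteq> 1"
    using prob_y_lim_0 by (auto simp: Q.prob_eq_0)
  with AE_y_iter_tendsto quenched_AE_Z_pos[OF no_ext] show ?thesis
  proof eventually_elim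
    case (elim \<omega>)
    have "0 < y_iter n \<xi> (real (Z n \<omega>))" "y_iter n \<xi> (real (Z n \<omega>)) < 1" for n
      using y_iter_range[OF no_ext, of "real (Z n \<omega>)" n] elim(2) by auto
    then have "0 \<le> y_lim \<xi> \<omega>" "y_lim \<xi> \<omega> \<le> 1"
      using LIMSEQ_le_const[OF elim(1), of 0] LIMSEQ_le_const2[OF elim(1), of 1]
      by (auto intro: less_imp_le)
    then show ?case
      using elim(3,4) by auto
  qed
qed

text \<open>Regularity says that \<open>exp_lim \<xi> s\<close> takes only the values 0 and 1 almost
  surely, so its mean \<open>exp (- s)\<close> is the probability of the value 1.\<close>

lemma regular_point_y_lim:
  assumes "regular_point \<xi> s"
  shows "Q.prob {\<omega>. y_lim \<xi> \<omega> \<le> exp (- s)} = exp (- s)" "Q.prob {\<omega>. y_lim \<xi> \<omega> = exp (- s)} = 0"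
proof -
  have s: "0 < s" "0 \<le> s" and W: "AE \<omega> in quenched \<xi>. W \<xi> s \<omega> \<in> {0, \<infinity>}"
    using assms by (auto simp: regular_point_def)
  have events: "{\<omega>. y_lim \<xi> \<omega> = a \<and> exp_lim \<xi> s \<omega> = b} \<in> Q.events" "{\<omega>. y_lim \<xi> \<omega> = a} \<in> Q.events"
    "{\<omega>. y_lim \<xi> \<omega> \<le> a} \<in> Q.events" "{\<omega>. exp_lim \<xi> s \<omega> = a} \<in> Q.events" for a b
  proof -
    have "{\<omega> \<in> space (quenched \<xi>). y_lim \<xi> \<omega> = a \<and> exp_lim \<xi> s \<omega> = b} \<in> Q.events"
      "{\<omega> \<in> space (quenched \<xi>). y_lim \<xi> \<omega> = a} \<in> Q.events"
      "{\<omega> \<in> space (quenched \<xi>). y_lim \<xi> \<omega> \<le> a} \<in> Q.events"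
      "{\<omega> \<in> space (quenched \<xi>). exp_lim \<xi> s \<omega> = a} \<in> Q.events"
      by measurable
    then show "{\<omega>. y_lim \<xi> \<omega> = a \<and> exp_lim \<xi> s \<omega> = b} \<in> Q.events" "{\<omega>. y_lim \<xi> \<omega> = a} \<in> Q.events"
      "{\<omega>. y_lim \<xi> \<omega> \<le> a} \<in> Q.events" "{\<omega>. exp_lim \<xi> s \<omega> = a} \<in> Q.events"
      by simp_all
  qed
  have dichotomy: "AE \<omega> in quenched \<xi>. exp_lim \<xi> s \<omega> = 0 \<or> exp_lim \<xi> s \<omega> = 1"
    using W AE_exp_mart_tendsto[OF s(2)] AE_exp_lim_bounds[OF s(2)]
  proof eventually_elim
    case (elim \<omega>)
    show ?case
    proof (cases "exp_lim \<xi> s \<omega> = 0")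
      case False
      then have "ennreal (- ln (exp_lim \<xi> s \<omega>)) \<in> {0, \<infinity>}"
        using elim(1) W_eq_exp_lim[OF elim(2)] by simp
      \<comment> \<open>\<open>ennreal\<close> sends all negative numbers to 0, so only an
        inequality results; the bound \<open>exp_lim \<xi> s \<omega> \<le> 1\<close> completes it
        to equality.\<close>
      then have "0 \<le> ln (exp_lim \<xi> s \<omega>)"
        by (auto simp: ennreal_eq_0_iff)
      then show ?thesis
        using False elim(3) by auto
    qed simp
  qed
  have "AE \<omega> in quenched \<xi>. \<not> (y_lim \<xi> \<omega> = exp (- s) \<and> exp_lim \<xi> s \<omega> = 0)"
    "AE \<omega> in quenched \<xi>. \<not> (y_lim \<xi> \<omega> = exp (- s) \<and> exp_lim \<xi> s \<omega> = 1)"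
    using prob_y_lim_exp_lim_zero[OF s(1)] prob_y_lim_exp_lim_one[OF s(2)] Q.prob_eq_0[OF events(1)] by auto
  with dichotomy have neq: "AE \<omega> in quenched \<xi>. y_lim \<xi> \<omega> \<noteq> exp (- s)"
    by eventually_elim auto
  then show "Q.prob {\<omega>. y_lim \<xi> \<omega> = exp (- s)} = 0"
    by (simp add: Q.prob_eq_0[OF events(2)])
  have "exp (- 1) < (1::real)"
    by simp
  \<comment> \<open>The threshold \<open>exp (- 1)\<close> separates the two possible values 0 and
    1, so the side of the level on which the limit lies determines the value.\<close>
  from dichotomy neq AE_y_lim_exp_lim[OF s(2)]
  have "AE \<omega> in quenched \<xi>. y_lim \<xi> \<omega> \<le> exp (- s) \<longleftrightarrow> exp_lim \<xi> s \<omega> = 1"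
  proof eventually_elim
    case (elim \<omega>)
    have "exp (- s) < y_lim \<xi> \<omega> \<or> y_lim \<xi> \<omega> < exp (- s)"
      using elim(2) by linarith
    then show ?case
      using elim(1,3) \<open>exp (- 1) < (1::real)\<close> by auto
  qed
  then have "Q.prob {\<omega>. y_lim \<xi> \<omega> \<le> exp (- s)} = Q.prob {\<omega>. exp_lim \<xi> s \<omega> = 1}"
    by (intro Q.finite_measure_eq_AE events) auto
  also have "\<dots> = (\<integral>\<omega>. indicator {\<omega>. exp_lim \<xi> s \<omega> = 1} \<omega> \<partial>quenched \<xi>)"
    by simp
  also have "\<dots> = Q.expectation (exp_lim \<xi> s)"
  proof (rule integral_cong_AE)
    show "AE \<omega> in quenched \<xi>. indicator {\<omega>. exp_lim \<xi> s \<omega> = 1} \<omega> = exp_lim \<xi> s \<omega>"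
      using dichotomy by eventually_elim auto
  qed (use events(4) in auto)
  finally show "Q.prob {\<omega>. y_lim \<xi> \<omega> \<le> exp (- s)} = exp (- s)"
    by (simp add: expectation_exp_lim[OF s(2)])
qed

text \<open>Every \<open>x\<close> in (0,1) is \<open>exp (- s)\<close> for the regular point
  \<open>s = - ln x\<close>, which gives the distribution function there; outside, the range of the
  limit decides.\<close>

lemma distr_y_lim_regular:
  assumes "regular_env \<xi>"
  shows "distr (quenched \<xi>) borel (y_lim \<xi>) = uniform_measure lborel {0<..<1}"
proof (rule cdf_unique)
  show "real_distribution (distr (quenched \<xi>) borel (y_lim \<xi>))"
    by (rule Q.real_distribution_distr) simp
  show "real_distribution (uniform_measure lborel {0<..<1})"
    by (intro real_distribution.intro real_distribution_axioms.intro prob_space_uniform_measure) auto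
  show "cdf (distr (quenched \<xi>) borel (y_lim \<xi>)) = cdf (uniform_measure lborel {0<..<1})"
  proof
    fix x :: real
    have "cdf (uniform_measure lborel {0<..<1}) x = measure lborel ({0<..<1} \<inter> {..x})"
      by (simp add: cdf_def measure_uniform_measure)
    also have "{0<..<1} \<inter> {..x} = (if x \<le> 0 then {} else if x < 1 then {0<..x} else {0<..<1})"
      by auto
    also have "measure lborel \<dots> = (if x \<le> 0 then 0 else if x < 1 then x else 1)"
      by simp
    finally have uniform: "cdf (uniform_measure lborel {0<..<1}) x = (if x \<le> 0 then 0 else if x < 1 then x else 1)" .
    have cdf: "cdf (distr (quenched \<xi>) borel (y_lim \<xi>)) x = Q.prob {\<omega>. y_lim \<xi> \<omega> \<le> x}"
      by (simp add: cdf_def measure_distr vimage_def)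
    have event: "{\<omega>. y_lim \<xi> \<omega> \<le> x} \<in> Q.events"
      using measurable_sets[OF measurable_y_lim, of "{..x}" \<xi>] by (simp add: vimage_def)
    consider "x \<le> 0" | "0 < x" "x < 1" | "1 \<le> x"
      by linarith
    then have "Q.prob {\<omega>. y_lim \<xi> \<omega> \<le> x} = (if x \<le> 0 then 0 else if x < 1 then x else 1)"
    proof cases
      case 1
      have "AE \<omega> in quenched \<xi>. \<not> y_lim \<xi> \<omega> \<le> x"
        using AE_y_lim_range by eventually_elim (use 1 in auto)
      then show ?thesis
        using 1 by (simp add: Q.prob_eq_0[OF event])
    next
      case 2
      then have "regular_point \<xi> (- ln x)"
        using assms by (simp add: regular_env_def)
      from regular_point_y_lim(1)[OF this] show ?thesis
        using 2 by simp
    next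
      case 3
      have "AE \<omega> in quenched \<xi>. y_lim \<xi> \<omega> \<le> x"
        using AE_y_lim_range by eventually_elim (use 3 in auto)
      then show ?thesis
        using 3 by (simp add: Q.prob_eq_1[OF event])
    qed
    then show "cdf (distr (quenched \<xi>) borel (y_lim \<xi>)) x = cdf (uniform_measure lborel {0<..<1}) x"
      by (simp add: cdf uniform)
  qed
qed

end

section \<open>Measurability in the environment\<close>

lemma measurable_pmf_dist_space: "(\<lambda>p. pmf p j) \<in> borel_measurable dist_space"
proof -
  have "(\<lambda>p. emeasure (measure_pmf p) {j}) \<in> borel_measurable dist_space"
    by (rule measurable_compose[OF measure_pmf_measurable_dist_space[THEN measurable_prob_algebraD]
          measurable_emeasure_subprob_algebra]) simp
  then have "(\<lambda>p. enn2real (emeasure (measure_pmf p) {j})) \<in> borel_measurable dist_space"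
    by measurable
  then show ?thesis
    by (simp add: pmf.rep_eq measure_def)
qed

text \<open>The argument \<open>s\<close> varies with \<open>x\<close> because unfolding
  \<open>f_iter\<close> replaces it by a generating function of the environment.\<close>

lemma measurable_f_iter:
  assumes "\<And>i. (\<lambda>x. e x i) \<in> M \<rightarrow>\<^sub>M dist_space" "s \<in> borel_measurable M"
  shows "(\<lambda>x. f_iter n (e x) (s x)) \<in> borel_measurable M"
  using assms(2)
proof (induction n arbitrary: s)
  case (Suc n)
  note [measurable] = Suc.prems measurable_compose[OF assms(1) measurable_pmf_dist_space]
  have "(\<lambda>x. pgf (e x (int n)) (s x)) \<in> borel_measurable M"
    unfolding pgf_def by measurable
  from Suc.IH[OF this] show ?case
    by simp
qed simp

lemma measurable_y_iter_Z:
  assumes "sets \<mu> = sets dist_space"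
  shows "(\<lambda>x. y_iter n (fst x) (real (Z n (snd x)))) \<in> borel_measurable (env_law \<mu> \<Otimes>\<^sub>M offspring_space)"
proof -
  let ?M = "env_law \<mu> \<Otimes>\<^sub>M offspring_space"
  have [measurable]: "(\<lambda>x. Z n (snd x)) \<in> ?M \<rightarrow>\<^sub>M count_space UNIV"
    unfolding offspring_space_def
    by (intro measurable_Z_compose measurable_compose[OF measurable_snd measurable_component_singleton]) simp
  have "(\<lambda>\<xi>. \<xi> i) \<in> env_law \<mu> \<rightarrow>\<^sub>M dist_space" for i
    unfolding measurable_cong_sets[OF sets_env_law[OF assms] refl] by measurable
  then have env: "(\<lambda>x. fst x i) \<in> ?M \<rightarrow>\<^sub>M dist_space" for i
    by (rule measurable_compose[OF measurable_fst])
  have "y_iter n (fst x) (real (Z n (snd x)))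
      = f_iter n (fst x) (if Z n (snd x) = 0 then 0 else exp (- 1 / real (Z n (snd x))))" for x
    by (simp add: y_iter_def)
  moreover have "(\<lambda>x. if Z n (snd x) = 0 then 0 else exp (- 1 / real (Z n (snd x)))) \<in> borel_measurable ?M"
    by measurable
  ultimately show ?thesis
    using measurable_f_iter[OF env] by simp
qed

text \<open>The hypothesis on coordinate 0 is a statement about the one-site law
  \<open>\<mu>\<close>, which is also the law of every other coordinate; countably many null sets
  are then united.\<close>

lemma AE_no_extinction:
  assumes "prob_space \<mu>" "sets \<mu> = sets dist_space" "AE \<xi> in env_law \<mu>. pmf (\<xi> 0) 0 = 0"
  shows "AE \<xi> in env_law \<mu>. no_extinction \<xi>"
proof -
  have pred: "{p \<in> space \<mu>. pmf p 0 = 0} \<in> sets \<mu>"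
    unfolding sets_eq_imp_space_eq[OF assms(2)] assms(2)
    using measurable_pmf_dist_space[of 0] by measurable
  have "AE p in distr (env_law \<mu>) \<mu> (\<lambda>\<xi>. \<xi> 0). pmf p 0 = 0"
    using assms(3) pred by (subst AE_distr_iff) (auto simp: env_law_def)
  moreover have "distr (env_law \<mu>) \<mu> (\<lambda>\<xi>. \<xi> 0) = \<mu>"
    unfolding env_law_def using distr_PiM_component[of UNIV "\<lambda>_. \<mu>" "0::int"] assms(1) by simp
  ultimately have "AE p in \<mu>. pmf p 0 = 0"
    by (simp only:)
  then have "AE \<xi> in env_law \<mu>. pmf (\<xi> (int n)) 0 = 0" for n
    unfolding env_law_def using assms(1) by (intro AE_PiM_component) auto
  then show ?thesis
    by (simp add: no_extinction_def AE_all_countable)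
qed

text \<open>Joint measurability makes the exceptional set an event, and its annealed probability is
  the integral of the quenched probabilities of its sections, almost all of which vanish.\<close>

lemma AE_annealedI:
  assumes "prob_space \<mu>" "sets \<mu> = sets dist_space"
    and P: "{x \<in> space (env_law \<mu> \<Otimes>\<^sub>M offspring_space). P x} \<in> sets (env_law \<mu> \<Otimes>\<^sub>M offspring_space)"
    and AE: "AE \<xi> in env_law \<mu>. AE \<omega> in quenched \<xi>. P (\<xi>, \<omega>)"
  shows "AE x in annealed \<mu>. P x"
proof -
  let ?M = "env_law \<mu> \<Otimes>\<^sub>M offspring_space"
  define N where "N = {x \<in> space ?M. \<not> P x}"
  have N: "N \<in> sets ?M"
    unfolding N_def using P by (rule sets.sets_Collect_neg)
  have space: "space (annealed \<mu>) = space ?M"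
    by (rule sets_eq_imp_space_eq[OF sets_annealed[OF assms(1,2)]])
  have "emeasure (annealed \<mu>) N = (\<integral>\<^sup>+\<xi>. emeasure (quenched \<xi>) {\<omega>. (\<xi>, \<omega>) \<in> N} \<partial>env_law \<mu>)"
    by (rule emeasure_annealed[OF assms(1,2) N])
  also have "\<dots> = (\<integral>\<^sup>+\<xi>. 0 \<partial>env_law \<mu>)"
  proof (rule nn_integral_cong_AE)
    show "AE \<xi> in env_law \<mu>. emeasure (quenched \<xi>) {\<omega>. (\<xi>, \<omega>) \<in> N} = 0"
      using AE
    proof eventually_elim
      case (elim \<xi>)
      have "{\<omega>. (\<xi>, \<omega>) \<in> N} \<in> sets (quenched \<xi>)"
        using sets_Pair1[OF N, of \<xi>] by (simp add: sets_quenched vimage_def)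
      moreover have "AE \<omega> in quenched \<xi>. \<not> (\<xi>, \<omega>) \<in> N"
        using elim by eventually_elim (simp add: N_def)
      ultimately show ?case
        by (subst (asm) AE_iff_measurable) auto
    qed
  qed
  finally have "emeasure (annealed \<mu>) N = 0"
    by simp
  then show ?thesis
    using N space sets_annealed[OF assms(1,2)] by (subst AE_iff_measurable) (auto simp: N_def)
qed

theorem theorem2p7:
  fixes \<mu> :: "nat pmf measure"
  assumes "prob_space \<mu>"
    and "sets \<mu> = sets dist_space"
    and "AE \<xi> in env_law \<mu>. pmf (\<xi> 0) 0 = 0"
    and "AE \<xi> in env_law \<mu>. \<xi> \<in> D"
  shows "\<exists>Y :: environment \<Rightarrow> offspring \<Rightarrow> real.
      (\<lambda>(\<xi>, \<omega>). Y \<xi> \<omega>) \<in> borel_measurable (annealed \<mu>) \<and>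
      (AE (\<xi>, \<omega>) in annealed \<mu>. (\<lambda>n. y_iter n \<xi> (real (Z n \<omega>))) \<longlonglongrightarrow> Y \<xi> \<omega>) \<and>
      (AE \<xi> in env_law \<mu>. AE \<omega> in quenched \<xi>. Y \<xi> \<omega> \<in> {0<..<1}) \<and>
      (AE \<xi> in env_law \<mu>. \<forall>s. regular_point \<xi> s \<longrightarrow>
         measure (quenched \<xi>) {\<omega> \<in> space (quenched \<xi>). Y \<xi> \<omega> \<le> exp (- s)} = exp (- s) \<and>
         measure (quenched \<xi>) {\<omega> \<in> space (quenched \<xi>). Y \<xi> \<omega> = exp (- s)} = 0) \<and>
      (regular_bp \<mu> \<longrightarrow>
         (AE \<xi> in env_law \<mu>. distr (quenched \<xi>) borel (Y \<xi>) = uniform_measure lborel {0<..<1}))"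
proof (intro exI[of _ y_lim] conjI impI)
  let ?M = "env_law \<mu> \<Otimes>\<^sub>M offspring_space"
  note no_ext = AE_no_extinction[OF assms(1-3)]
  note [measurable] = measurable_y_iter_Z[OF assms(2)]
  have y_lim [measurable]: "(\<lambda>x. y_lim (fst x) (snd x)) \<in> borel_measurable ?M"
    unfolding y_lim_def by measurable
  then show "(\<lambda>(\<xi>, \<omega>). y_lim \<xi> \<omega>) \<in> borel_measurable (annealed \<mu>)"
    unfolding measurable_cong_sets[OF sets_annealed[OF assms(1,2)] refl] by (simp add: case_prod_unfold)
  have "{x \<in> space ?M. (\<lambda>n. y_iter n (fst x) (real (Z n (snd x)))) \<longlonglongrightarrow> y_lim (fst x) (snd x)} \<in> sets ?M"
    by measurable
  moreover have "AE \<xi> in env_law \<mu>. AE \<omega> in quenched \<xi>. (\<lambda>n. y_iter n \<xi> (real (Z n \<omega>))) \<longlonglongrightarrow> y_lim \<xi> \<omega>"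
    using no_ext by eventually_elim (rule AE_y_iter_tendsto)
  ultimately show "AE (\<xi>, \<omega>) in annealed \<mu>. (\<lambda>n. y_iter n \<xi> (real (Z n \<omega>))) \<longlonglongrightarrow> y_lim \<xi> \<omega>"
    using AE_annealedI[OF assms(1,2), of "\<lambda>x. (\<lambda>n. y_iter n (fst x) (real (Z n (snd x)))) \<longlonglongrightarrow> y_lim (fst x) (snd x)"]
    by (simp add: case_prod_unfold)
  show "AE \<xi> in env_law \<mu>. AE \<omega> in quenched \<xi>. y_lim \<xi> \<omega> \<in> {0<..<1}"
    using no_ext by eventually_elim (rule AE_y_lim_range)
  \<comment> \<open>\<open>no_extinction\<close> does not mention \<open>s\<close>, so one null set
    of environments serves all regular points at once.\<close>
  show "AE \<xi> in env_law \<mu>. \<forall>s. regular_point \<xi> s \<longrightarrow>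
      measure (quenched \<xi>) {\<omega> \<in> space (quenched \<xi>). y_lim \<xi> \<omega> \<le> exp (- s)} = exp (- s) \<and>
      measure (quenched \<xi>) {\<omega> \<in> space (quenched \<xi>). y_lim \<xi> \<omega> = exp (- s)} = 0"
    using no_ext by eventually_elim (simp add: regular_point_y_lim)
  assume "regular_bp \<mu>"
  then have "AE \<xi> in env_law \<mu>. regular_env \<xi>"
    by (simp add: regular_bp_def)
  with no_ext show "AE \<xi> in env_law \<mu>. distr (quenched \<xi>) borel (y_lim \<xi>) = uniform_measure lborel {0<..<1}"
    by eventually_elim (rule distr_y_lim_regular)
qed

end
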